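(* Let $M$ be a finite-dimensional Riemannian manifold, $S$ a closed prox-regular subset of $M$, $x\in S$ and $v\in T_xM$. Then $v\in T^B_S(x)$ if and only if there exists a continuous curve $\alpha:[0,\varepsilon)\to S$ (for some $\varepsilon>0$) such that $\alpha(0)=x$ and $\dot\alpha(0^+)=v$, where $\dot\alpha(0^+)$ is the right-handed derivative of $\alpha$ at $0$ (as a curve in $M$).
   Context: $M$ carries a Riemannian metric $\langle\cdot,\cdot\rangle$ with Riemannian distance $d$; $B(x,r)$ is the open metric ball. A convex set (or neighborhood, or ball) in $M$ means a strongly convex one: any two of its points are joined by a unique minimizing geodesic of $M$, and this geodesic lies in the set; for $x,y$ in a convex neighborhood, $\exp_x^{-1}y$ is the initial velocity of the minimizing geodesic $[0,1]\to M$ from $x$ to $y$. Proximal normal cone: for a nonempty closed $S\subseteq M$ and $x\in S$, $\xi\in T_xM$ belongs to $N^P_S(x)$ iff there is $\sigma>0$ such that $\langle\xi,\exp_x^{-1}y\rangle\le\sigma\, d^2(x,y)$ for every $y\in U\cap S$, where $U$ is a convex neighborhood of $x$. Prox-regular: a closed set $S\subseteq M$ is prox-regular at $\bar x\in S$ if there exist $\varepsilon>0$ and $\sigma>0$ such that $B(\bar x,\varepsilon)$ is convex and for every $x\in S\cap B(\bar x,\varepsilon)$ and $v\in N^P_S(x)$ with $\|v\|<\varepsilon$ one has $\langle v,\exp_x^{-1}y\rangle\le\sigma\,d^2(x,y)$ for every $y\in S\cap B(\bar x,\varepsilon)$. $S$ is prox-regular if it is so at each of its points. Bouligand tangent cone: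 $T^B_S(x)=\{\lim_{i\to\infty}\frac{\exp_x^{-1}z_i}{t_i}: z_i\in U\cap S,\ z_i\to x,\ t_i\downarrow 0\}$, with $U$ a convex neighborhood of $x$. *)

theory Defs
  imports "HOL-Analysis.Analysis"
begin

section \<open>Smooth manifolds\<close>

text \<open>A manifold is a Hausdorff, second countable type \<open>'m\<close> together with a (not necessarily
  maximal) smooth atlas of charts into a Euclidean space \<open>'e\<close>, of arbitrary dimension
  at least 1. It need not be connected.
  A chart is a pair of its domain and its map; the values of the map outside the domain are
  irrelevant.\<close>

type_synonym ('m, 'e) chart = "'m set \<times> ('m \<Rightarrow> 'e)"

abbreviation chart_inv :: "('m, 'e) chart \<Rightarrow> 'e \<Rightarrow> 'm" where
  "chart_inv c \<equiv> inv_into (fst c) (snd c)"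

primrec Ck_on :: "nat \<Rightarrow> ('a::real_normed_vector \<Rightarrow> 'b::real_normed_vector) \<Rightarrow> 'a set \<Rightarrow> bool" where
  "Ck_on 0 f X \<longleftrightarrow> continuous_on X f"
| "Ck_on (Suc k) f X \<longleftrightarrow>
     (\<forall>x\<in>X. f differentiable (at x)) \<and> (\<forall>h. Ck_on k (\<lambda>x. frechet_derivative f (at x) h) X)"

definition smooth_on :: "('a::real_normed_vector \<Rightarrow> 'b::real_normed_vector) \<Rightarrow> 'a set \<Rightarrow> bool" where
  "smooth_on f X \<longleftrightarrow> (\<forall>k. Ck_on k f X)"

definition smooth_atlas ::
  "('m::{t2_space, second_countable_topology}, 'e::euclidean_space) chart set \<Rightarrow> bool" where
  "smooth_atlas A \<longleftrightarrow>
     (\<Union>c\<in>A. fst c) = UNIV \<and>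
     (\<forall>c\<in>A. open (fst c) \<and> open (snd c ` fst c) \<and>
        homeomorphism (fst c) (snd c ` fst c) (snd c) (chart_inv c)) \<and>
     (\<forall>c\<in>A. \<forall>c'\<in>A. smooth_on (snd c' \<circ> chart_inv c) (snd c ` (fst c \<inter> fst c')))"

text \<open>A tangent vector at \<open>p\<close> is the family of its coordinates in the charts around \<open>p\<close>, any two of
  which are related by the derivative of the transition map; it is extended by \<open>0\<close> to everything
  that is not a chart around \<open>p\<close>. The vector space operations are therefore pointwise.\<close>

type_synonym ('m, 'e) tvec = "('m, 'e) chart \<Rightarrow> 'e"

definition trans_deriv ::
  "('m, 'e::euclidean_space) chart \<Rightarrow> ('m, 'e) chart \<Rightarrow> 'm \<Rightarrow> 'e \<Rightarrow> 'e" where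
  "trans_deriv c c' p = frechet_derivative (snd c' \<circ> chart_inv c) (at (snd c p))"

definition tangent_space ::
  "('m, 'e::euclidean_space) chart set \<Rightarrow> 'm \<Rightarrow> ('m, 'e) tvec set" where
  "tangent_space A p =
     {v. (\<forall>c\<in>A. \<forall>c'\<in>A. p \<in> fst c \<and> p \<in> fst c' \<longrightarrow> v c' = trans_deriv c c' p (v c)) \<and>
         (\<forall>c. \<not> (c \<in> A \<and> p \<in> fst c) \<longrightarrow> v c = 0)}"

text \<open>The tangent vector at \<open>p\<close> whose coordinates in the chart \<open>c\<close> are \<open>e\<close>.\<close>

definition coord_vec ::
  "('m, 'e::euclidean_space) chart set \<Rightarrow> ('m, 'e) chart \<Rightarrow> 'm \<Rightarrow> 'e \<Rightarrow> ('m, 'e) tvec" where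
  "coord_vec A c p e = (\<lambda>c'. if c' \<in> A \<and> p \<in> fst c' then trans_deriv c c' p e else 0)"


section \<open>Curves\<close>

text \<open>The derivative at \<open>t\<close> is taken relative to the parameter set \<open>T\<close>, so it is one-sided at the
  end points of an interval. Continuity at \<open>t\<close> keeps the curve inside each chart around
  \<open>\<gamma> t\<close> for parameters near \<open>t\<close>.\<close>

definition has_velocity ::
  "('m::topological_space, 'e::euclidean_space) chart set \<Rightarrow> (real \<Rightarrow> 'm) \<Rightarrow> ('m, 'e) tvec
     \<Rightarrow> real \<Rightarrow> real set \<Rightarrow> bool" where
  "has_velocity A \<gamma> v t T \<longleftrightarrow>
     v \<in> tangent_space A (\<gamma> t) \<and> continuous (at t within T) \<gamma> \<and>
     (\<forall>c\<in>A. \<gamma> t \<in> fst c \<longrightarrow> ((\<lambda>s. snd c (\<gamma> s)) has_vector_derivative v c) (at t within T))"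

definition velocity ::
  "('m::topological_space, 'e::euclidean_space) chart set \<Rightarrow> (real \<Rightarrow> 'm) \<Rightarrow> real set
     \<Rightarrow> real \<Rightarrow> ('m, 'e) tvec" where
  "velocity A \<gamma> T t =
     (\<lambda>c. if c \<in> A \<and> \<gamma> t \<in> fst c
          then vector_derivative (\<lambda>s. snd c (\<gamma> s)) (at t within T) else 0)"

definition C1_curve_on ::
  "('m::topological_space, 'e::euclidean_space) chart set \<Rightarrow> (real \<Rightarrow> 'm) \<Rightarrow> real set \<Rightarrow> bool" where
  "C1_curve_on A \<gamma> T \<longleftrightarrow>
     (\<forall>t\<in>T. has_velocity A \<gamma> (velocity A \<gamma> T t) t T) \<and>
     (\<forall>c\<in>A. continuous_on {t\<in>T. \<gamma> t \<in> fst c} (\<lambda>t. velocity A \<gamma> T t c))"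

definition piecewise_C1_curve ::
  "('m::topological_space, 'e::euclidean_space) chart set \<Rightarrow> (real \<Rightarrow> 'm) \<Rightarrow> bool" where
  "piecewise_C1_curve A \<gamma> \<longleftrightarrow>
     (\<exists>K. finite K \<and> {0, 1} \<subseteq> K \<and> K \<subseteq> {0..1} \<and>
        (\<forall>a\<in>K. \<forall>b\<in>K. a < b \<and> K \<inter> {a<..<b} = {} \<longrightarrow> C1_curve_on A \<gamma> {a..b}))"


section \<open>Riemannian metrics\<close>

type_synonym ('m, 'e) metric = "'m \<Rightarrow> ('m, 'e) tvec \<Rightarrow> ('m, 'e) tvec \<Rightarrow> real"

text \<open>The component \<open>\<langle>e, e'\<rangle>\<close> of the metric in the chart \<open>c\<close>, as a function on the chart image.\<close>

definition metric_coeff ::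
  "('m, 'e::euclidean_space) chart set \<Rightarrow> ('m, 'e) metric \<Rightarrow> ('m, 'e) chart
     \<Rightarrow> 'e \<Rightarrow> 'e \<Rightarrow> 'e \<Rightarrow> real" where
  "metric_coeff A g c e e' q =
     (let p = chart_inv c q in g p (coord_vec A c p e) (coord_vec A c p e'))"

definition riemannian_metric ::
  "('m, 'e::euclidean_space) chart set \<Rightarrow> ('m, 'e) metric \<Rightarrow> bool" where
  "riemannian_metric A g \<longleftrightarrow>
     (\<forall>p. \<forall>u\<in>tangent_space A p. \<forall>v\<in>tangent_space A p.
        g p u v = g p v u \<and>
        (\<forall>w\<in>tangent_space A p. g p (\<lambda>c. u c + v c) w = g p u w + g p v w) \<and>
        (\<forall>r. g p (\<lambda>c. r *\<^sub>R u c) v = r * g p u v) \<and>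
        (u \<noteq> (\<lambda>c. 0) \<longrightarrow> g p u u > 0)) \<and>
     (\<forall>c\<in>A. \<forall>e e'. smooth_on (metric_coeff A g c e e') (snd c ` fst c))"

definition riemannian_manifold ::
  "('m::{t2_space, second_countable_topology}, 'e::euclidean_space) chart set
     \<Rightarrow> ('m, 'e) metric \<Rightarrow> bool" where
  "riemannian_manifold A g \<longleftrightarrow> smooth_atlas A \<and> riemannian_metric A g"

definition tnorm :: "('m, 'e) metric \<Rightarrow> 'm \<Rightarrow> ('m, 'e) tvec \<Rightarrow> real" where
  "tnorm g p v = sqrt (g p v v)"

text \<open>At the finitely many break points of a piecewise \<open>C\<^sup>1\<close> curve the integrand is arbitrary.\<close>

definition curve_length ::
  "('m::topological_space, 'e::euclidean_space) chart set \<Rightarrow> ('m, 'e) metric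
     \<Rightarrow> (real \<Rightarrow> 'm) \<Rightarrow> real" where
  "curve_length A g \<gamma> = integral {0..1} (\<lambda>t. tnorm g (\<gamma> t) (velocity A \<gamma> {0..1} t))"

text \<open>The distance is \<open>\<infinity>\<close> between points in different connected components.\<close>

definition rdist ::
  "('m::topological_space, 'e::euclidean_space) chart set \<Rightarrow> ('m, 'e) metric
     \<Rightarrow> 'm \<Rightarrow> 'm \<Rightarrow> ereal" where
  "rdist A g x y =
     (INF \<gamma>\<in>{\<gamma>. piecewise_C1_curve A \<gamma> \<and> \<gamma> 0 = x \<and> \<gamma> 1 = y}. ereal (curve_length A g \<gamma>))"

definition rball ::
  "('m::topological_space, 'e::euclidean_space) chart set \<Rightarrow> ('m, 'e) metric
     \<Rightarrow> 'm \<Rightarrow> real \<Rightarrow> 'm set" where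
  "rball A g x r = {y. rdist A g x y < ereal r}"


section \<open>Geodesics and convexity\<close>

text \<open>The Christoffel symbols of the second kind, as a symmetric bilinear map on coordinate vectors:
  \<open>\<langle>\<Gamma>(u,v), w\<rangle> = (D\<^sub>u\<langle>v,w\<rangle> + D\<^sub>v\<langle>u,w\<rangle> - D\<^sub>w\<langle>u,v\<rangle>) / 2\<close> for all constant \<open>w\<close>.\<close>

definition christoffel ::
  "('m, 'e::euclidean_space) chart set \<Rightarrow> ('m, 'e) metric \<Rightarrow> ('m, 'e) chart
     \<Rightarrow> 'm \<Rightarrow> 'e \<Rightarrow> 'e \<Rightarrow> 'e" where
  "christoffel A g c p u v =
     (let q = snd c p; D = (\<lambda>a e e'. frechet_derivative (metric_coeff A g c e e') (at q) a) in
      THE k. \<forall>w. metric_coeff A g c k w q = (D u v w + D v u w - D w u v) / 2)"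

text \<open>Geodesics are parametrized on \<open>[0,1]\<close> and solve \<open>\<gamma>'' + \<Gamma>(\<gamma>',\<gamma>') = 0\<close> in every chart.\<close>

definition geodesic ::
  "('m::topological_space, 'e::euclidean_space) chart set \<Rightarrow> ('m, 'e) metric
     \<Rightarrow> (real \<Rightarrow> 'm) \<Rightarrow> bool" where
  "geodesic A g \<gamma> \<longleftrightarrow>
     (let \<gamma>' = velocity A \<gamma> {0..1} in
      \<forall>t\<in>{0..1}. has_velocity A \<gamma> (\<gamma>' t) t {0..1} \<and>
        (\<forall>c\<in>A. \<gamma> t \<in> fst c \<longrightarrow>
           ((\<lambda>s. \<gamma>' s c) has_vector_derivative - christoffel A g c (\<gamma> t) (\<gamma>' t c) (\<gamma>' t c))
             (at t within {0..1})))"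

definition minimizing_geodesic ::
  "('m::topological_space, 'e::euclidean_space) chart set \<Rightarrow> ('m, 'e) metric
     \<Rightarrow> 'm \<Rightarrow> 'm \<Rightarrow> (real \<Rightarrow> 'm) \<Rightarrow> bool" where
  "minimizing_geodesic A g x y \<gamma> \<longleftrightarrow>
     geodesic A g \<gamma> \<and> \<gamma> 0 = x \<and> \<gamma> 1 = y \<and> ereal (curve_length A g \<gamma>) = rdist A g x y"

definition strongly_convex ::
  "('m::topological_space, 'e::euclidean_space) chart set \<Rightarrow> ('m, 'e) metric
     \<Rightarrow> 'm set \<Rightarrow> bool" where
  "strongly_convex A g C \<longleftrightarrow>
     (\<forall>x\<in>C. \<forall>y\<in>C. \<exists>\<gamma>. minimizing_geodesic A g x y \<gamma> \<and>
        (\<forall>\<delta>. minimizing_geodesic A g x y \<delta> \<longrightarrow> (\<forall>t\<in>{0..1}. \<delta> t = \<gamma> t)) \<and>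
        \<gamma> ` {0..1} \<subseteq> C)"

definition convex_nbhd ::
  "('m::topological_space, 'e::euclidean_space) chart set \<Rightarrow> ('m, 'e) metric
     \<Rightarrow> 'm \<Rightarrow> 'm set \<Rightarrow> bool" where
  "convex_nbhd A g x U \<longleftrightarrow> x \<in> interior U \<and> strongly_convex A g U"

text \<open>\<open>exp\<^sub>x\<^sup>-\<^sup>1 y\<close>, meaningful only if the minimizing geodesic from \<open>x\<close> to \<open>y\<close> is unique, in
  particular for \<open>x\<close>, \<open>y\<close> in a common strongly convex set. The choice is harmless then: a
  minimizing geodesic is unique on \<open>[0,1]\<close>, although not as a function on all of \<open>real\<close>.\<close>

definition exp_inv ::
  "('m::topological_space, 'e::euclidean_space) chart set \<Rightarrow> ('m, 'e) metric
     \<Rightarrow> 'm \<Rightarrow> 'm \<Rightarrow> ('m, 'e) tvec" where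
  "exp_inv A g x y = velocity A (SOME \<gamma>. minimizing_geodesic A g x y \<gamma>) {0..1} 0"


section \<open>Proximal normals, prox-regularity, Bouligand tangents\<close>

text \<open>The cones below do not depend on the choice of the convex neighborhood \<open>U\<close>, which is
  quantified existentially.\<close>

definition proximal_normal_cone ::
  "('m::topological_space, 'e::euclidean_space) chart set \<Rightarrow> ('m, 'e) metric
     \<Rightarrow> 'm set \<Rightarrow> 'm \<Rightarrow> ('m, 'e) tvec set" where
  "proximal_normal_cone A g S x =
     {\<xi> \<in> tangent_space A x. \<exists>\<sigma>>0. \<exists>U. convex_nbhd A g x U \<and>
        (\<forall>y\<in>U \<inter> S. ereal (g x \<xi> (exp_inv A g x y)) \<le> ereal \<sigma> * (rdist A g x y)\<^sup>2)}"

definition prox_regular_at ::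
  "('m::topological_space, 'e::euclidean_space) chart set \<Rightarrow> ('m, 'e) metric
     \<Rightarrow> 'm set \<Rightarrow> 'm \<Rightarrow> bool" where
  "prox_regular_at A g S z \<longleftrightarrow>
     (\<exists>\<epsilon>>0. \<exists>\<sigma>>0. strongly_convex A g (rball A g z \<epsilon>) \<and>
        (\<forall>x\<in>S \<inter> rball A g z \<epsilon>. \<forall>v\<in>proximal_normal_cone A g S x. tnorm g x v < \<epsilon> \<longrightarrow>
           (\<forall>y\<in>S \<inter> rball A g z \<epsilon>.
              ereal (g x v (exp_inv A g x y)) \<le> ereal \<sigma> * (rdist A g x y)\<^sup>2)))"

definition prox_regular ::
  "('m::topological_space, 'e::euclidean_space) chart set \<Rightarrow> ('m, 'e) metric
     \<Rightarrow> 'm set \<Rightarrow> bool" where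
  "prox_regular A g S \<longleftrightarrow> closed S \<and> (\<forall>z\<in>S. prox_regular_at A g S z)"

definition bouligand_cone ::
  "('m::topological_space, 'e::euclidean_space) chart set \<Rightarrow> ('m, 'e) metric
     \<Rightarrow> 'm set \<Rightarrow> 'm \<Rightarrow> ('m, 'e) tvec set" where
  "bouligand_cone A g S x =
     {v \<in> tangent_space A x. \<exists>U z \<tau>. convex_nbhd A g x U \<and>
        range z \<subseteq> U \<inter> S \<and> z \<longlonglongrightarrow> x \<and>
        (\<forall>i. 0 < \<tau> i) \<and> decseq \<tau> \<and> \<tau> \<longlonglongrightarrow> 0 \<and>
        (\<forall>c\<in>A. x \<in> fst c \<longrightarrow> (\<lambda>i. exp_inv A g x (z i) c /\<^sub>R \<tau> i) \<longlonglongrightarrow> v c)}"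

end

(*
In a chart around x the metric is comparable to the Euclidean one, a short minimizing geodesic
stays in the chart, and the geodesic equation shows that exp_p^{-1} p' differs from the coordinate
difference p' - p by O(|p' - p|^2). Prox-regularity of S therefore becomes the Euclidean inequality
n.(y - q) <= \<sigma> |n| |y - q|^2 for Euclidean proximal normals n of the coordinate image K of S, and the
Bouligand cone at x becomes the Euclidean one. The inequality makes the nearest point map P of K
Lipschitz near the coordinates q0 of x. The curve is P(q0 + t w): the distance from q0 + t w to K
is o(t), because the distance to K from a point on the segment between q0 and k in K, at the
fraction l of the way, is O(l |k - q0|^2).
*)
theory Submission
  imports Defs
begin

text \<open>The obstacle: a Bouligand tangent controls \<open>S\<close> only along the times
  \<open>\<tau> i\<close>, while a right derivative needs every small time. A nearest point map
  turns the tangent ray into a curve in the set, but on a nonconvex set its continuity has to be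
  earned, and prox-regularity gives it only near the base point. No geodesic is constructed.
  Geodesics come from the strong convexity of the sets in the definitions, so every fact about
  \<open>exp_inv\<close> is read off from a given minimizing geodesic by mean value estimates.
  Euclidean normals enter as p - P p, whose normal inequality has the constant 1/2 on all of K.
  Prox-regularity of \<open>S\<close> speaks only of normals shorter than \<epsilon>; this is why
  normals are rescaled, and why |n| appears in the Euclidean inequality. A proximal normal of
  \<open>S\<close> is tested on a convex neighborhood that may leave the chart, whereas K is cut off
  by a closed coordinate ball. At points beyond the chart the distance is bounded below, so a linear
  bound there is already a quadratic one.\<close>

section \<open>Nearest points of Euclidean prox-regular sets\<close>

lemma closest_point_proximal:
  fixes K :: "'e::euclidean_space set"
  assumes "closed K" "k \<in> K"
  shows "(p - closest_point K p) \<bullet> (k - closest_point K p) \<le> (norm (k - closest_point K p))\<^sup>2 / 2"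
proof -
  have "norm (p - closest_point K p) \<le> norm (p - k)"
    using closest_point_le[OF assms, of p] by (simp add: dist_norm)
  then have "(norm (p - closest_point K p))\<^sup>2 \<le> (norm ((p - closest_point K p) - (k - closest_point K p)))\<^sup>2"
    by (simp add: power_mono)
  also have "\<dots> = (norm (p - closest_point K p))\<^sup>2 - 2 * ((p - closest_point K p) \<bullet> (k - closest_point K p))
      + (norm (k - closest_point K p))\<^sup>2"
    by (simp add: power2_norm_eq_inner algebra_simps inner_commute)
  finally show ?thesis by simp
qed

text \<open>The premise on \<open>n\<close>, with constant 1/2 and tested on all of
  \<open>K\<close>, is the form in which p - P p is a normal. The factor \<open>norm n\<close> makes
  the inequality sharper for short normals, that is, for points close to \<open>K\<close>; every
  absorption argument below lives on this gain.\<close>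

locale euclidean_prox_regular =
  fixes K :: "'e::euclidean_space set" and q0 :: 'e and r \<sigma> :: real
  assumes closed_K: "closed K" and q0_K: "q0 \<in> K" and r_pos: "r > 0" and \<sigma>_pos: "\<sigma> > 0"
    and prox: "\<And>q n y. \<lbrakk>q \<in> K; dist q q0 < r; y \<in> K; dist y q0 < r;
       \<forall>k\<in>K. n \<bullet> (k - q) \<le> (norm (k - q))\<^sup>2 / 2\<rbrakk> \<Longrightarrow> n \<bullet> (y - q) \<le> \<sigma> * norm n * (norm (y - q))\<^sup>2"
begin

abbreviation P :: "'e \<Rightarrow> 'e" where "P \<equiv> closest_point K"

text \<open>\<open>P p\<close> is at most twice as far from \<open>q0\<close> as \<open>p\<close>
  is, so r/2 keeps it in the ball where \<open>prox\<close> applies. The bound 1/(4\<sigma>) gives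
  \<sigma> |p - P p| \<le> 1/4, small enough to absorb quadratic terms.\<close>

definition \<rho> :: real where "\<rho> = min (r / 2) (1 / (4 * \<sigma>))"

lemma \<rho>_pos: "\<rho> > 0" and \<rho>_less: "\<rho> < r" and \<sigma>_\<rho>: "\<sigma> * \<rho> \<le> 1 / 4"
  using r_pos \<sigma>_pos by (auto simp: \<rho>_def min_def field_simps)

lemma P_in: "P p \<in> K"
  using closest_point_in_set[OF closed_K] q0_K by blast

lemma norm_P_le: "k \<in> K \<Longrightarrow> norm (p - P p) \<le> norm (p - k)"
  using closest_point_le[OF closed_K, of k p] by (simp add: dist_norm)

lemma P_self: "k \<in> K \<Longrightarrow> P k = k"
  by (simp add: closest_point_self)

lemma P_near:
  assumes "norm (p - q0) < \<rho>"
  shows "dist (P p) q0 < r" "\<sigma> * norm (p - P p) \<le> 1 / 4"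
proof -
  have 1: "norm (p - P p) \<le> norm (p - q0)" by (rule norm_P_le[OF q0_K])
  have "norm (P p - q0) \<le> norm (p - P p) + norm (p - q0)"
    using norm_triangle_ineq4[of "p - q0" "p - P p"] by simp
  also have "\<dots> < r" using 1 assms unfolding \<rho>_def by linarith
  finally show "dist (P p) q0 < r" by (simp add: dist_norm)
  have "\<sigma> * norm (p - P p) \<le> \<sigma> * \<rho>" using 1 assms \<sigma>_pos by (intro mult_left_mono) auto
  then show "\<sigma> * norm (p - P p) \<le> 1 / 4" using \<sigma>_\<rho> by linarith
qed

lemma prox_P:
  assumes "norm (p - q0) < \<rho>" "y \<in> K" "dist y q0 < r"
  shows "(p - P p) \<bullet> (y - P p) \<le> \<sigma> * norm (p - P p) * (norm (y - P p))\<^sup>2"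
  by (rule prox[OF P_in P_near(1)[OF assms(1)] assms(2,3)])
     (use closest_point_proximal[OF closed_K] in auto)

text \<open>The normal inequalities at \<open>P a\<close> and at \<open>P b\<close> are added. The
  left sides sum to |P a - P b|^2 - (a - b).(P a - P b), the right sides to at most |P a - P b|^2 /
  2; half of the square survives, whence the constant 2.\<close>

lemma P_lipschitz:
  assumes "norm (a - q0) < \<rho>" "norm (b - q0) < \<rho>"
  shows "norm (P a - P b) \<le> 2 * norm (a - b)"
proof -
  let ?N = "norm (P a - P b)"
  have bd: "(p - P p) \<bullet> (P q - P p) \<le> ?N\<^sup>2 / 4"
    if "norm (p - q0) < \<rho>" "norm (q - q0) < \<rho>" "norm (P q - P p) = ?N" for p q
  proof -
    have "(p - P p) \<bullet> (P q - P p) \<le> \<sigma> * norm (p - P p) * (norm (P q - P p))\<^sup>2"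
      by (rule prox_P) (use that P_in P_near in auto)
    also have "\<dots> \<le> 1 / 4 * (norm (P q - P p))\<^sup>2"
      by (intro mult_right_mono P_near that) auto
    finally show ?thesis using that(3) by simp
  qed
  have "(a - P a) \<bullet> (P b - P a) + (b - P b) \<bullet> (P a - P b) \<le> ?N\<^sup>2 / 2"
    using bd[of a b] bd[of b a] assms by (simp add: norm_minus_commute)
  moreover have "(a - P a) \<bullet> (P b - P a) + (b - P b) \<bullet> (P a - P b) = ?N\<^sup>2 - (a - b) \<bullet> (P a - P b)"
    by (simp add: power2_norm_eq_inner algebra_simps inner_commute)
  moreover have "(a - b) \<bullet> (P a - P b) \<le> norm (a - b) * ?N" by (rule norm_cauchy_schwarz)
  ultimately have "?N * ?N \<le> (2 * norm (a - b)) * ?N" by (simp add: power2_eq_square)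
  then show ?thesis
    by (cases "?N = 0") (auto simp: mult_le_cancel_right)
qed

text \<open>The displacement n = m - P m is itself the convex combination of q0 - P m and k - P m,
  so pairing it with n and using the normal inequality at both end points bounds |n|^2. What matters
  is the factor l: the bound is linear in the position on the segment.\<close>

lemma segment_near:
  assumes k: "k \<in> K" "norm (k - q0) < \<rho>" and l: "0 \<le> l" "l \<le> 1"
  shows "norm (q0 + l *\<^sub>R (k - q0) - P (q0 + l *\<^sub>R (k - q0))) \<le> 2 * \<sigma> * l * (norm (k - q0))\<^sup>2"
proof -
  define m where "m = q0 + l *\<^sub>R (k - q0)"
  let ?n = "m - P m"
  have "norm (m - q0) = l * norm (k - q0)" using l by (simp add: m_def)
  also have "\<dots> \<le> 1 * norm (k - q0)" using l by (intro mult_right_mono) auto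
  finally have m: "norm (m - q0) < \<rho>" using k by simp
  have a: "?n \<bullet> (q0 - P m) \<le> \<sigma> * norm ?n * (norm (q0 - P m))\<^sup>2"
    by (rule prox_P[OF m q0_K]) (use r_pos in simp)
  have b: "?n \<bullet> (k - P m) \<le> \<sigma> * norm ?n * (norm (k - P m))\<^sup>2"
    by (rule prox_P[OF m k(1)]) (use k \<rho>_less in \<open>simp add: dist_norm\<close>)
  have id: "?n = (1 - l) *\<^sub>R (q0 - P m) + l *\<^sub>R (k - P m)"
    by (simp add: m_def algebra_simps)
  \<comment> \<open>Stewart's theorem for \<open>P m\<close> and the point \<open>m\<close> on the
    segment from \<open>q0\<close> to \<open>k\<close>.\<close>
  have id2: "(1 - l) * (norm (q0 - P m))\<^sup>2 + l * (norm (k - P m))\<^sup>2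
      = (norm ?n)\<^sup>2 + l * (1 - l) * (norm (k - q0))\<^sup>2"
    unfolding power2_norm_eq_inner unfolding m_def
    by (simp add: algebra_simps inner_commute)
  have "norm ?n * norm ?n = ?n \<bullet> ?n" by (metis power2_eq_square power2_norm_eq_inner)
  also have "\<dots> = ?n \<bullet> ((1 - l) *\<^sub>R (q0 - P m) + l *\<^sub>R (k - P m))"
    by (rule arg_cong[where f="\<lambda>z. ?n \<bullet> z"], rule id)
  also have "\<dots> = (1 - l) * (?n \<bullet> (q0 - P m)) + l * (?n \<bullet> (k - P m))"
    by (simp only: inner_add_right inner_scaleR_right)
  also have "\<dots> \<le> (1 - l) * (\<sigma> * norm ?n * (norm (q0 - P m))\<^sup>2) + l * (\<sigma> * norm ?n * (norm (k - P m))\<^sup>2)"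
    using l by (intro add_mono mult_left_mono a b) auto
  also have "\<dots> = norm ?n * (\<sigma> * ((1 - l) * (norm (q0 - P m))\<^sup>2 + l * (norm (k - P m))\<^sup>2))"
    by (simp add: algebra_simps)
  also have "\<dots> = norm ?n * (\<sigma> * norm ?n * norm ?n + \<sigma> * (l * (1 - l) * (norm (k - q0))\<^sup>2))"
    unfolding id2 by (simp add: algebra_simps power2_eq_square)
  finally have "norm ?n \<le> \<sigma> * norm ?n * norm ?n + \<sigma> * (l * (1 - l) * (norm (k - q0))\<^sup>2)
      \<or> norm ?n = 0"
    by (auto simp: mult_le_cancel_left)
  \<comment> \<open>The quadratic term goes to the left side; the resulting factor 4/3 is rounded up
    to 2.\<close>
  moreover have "\<sigma> * norm ?n * norm ?n \<le> 1 / 4 * norm ?n"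
    by (intro mult_right_mono P_near m) auto
  moreover have "\<sigma> * (l * (1 - l) * (norm (k - q0))\<^sup>2) \<le> \<sigma> * (l * 1 * (norm (k - q0))\<^sup>2)"
    using l \<sigma>_pos by (intro mult_left_mono mult_right_mono) auto
  moreover have "0 \<le> \<sigma> * (l * (norm (k - q0))\<^sup>2)" using l \<sigma>_pos by simp
  ultimately have "norm ?n \<le> 2 * (\<sigma> * (l * (norm (k - q0))\<^sup>2))" by auto
  then show ?thesis by (simp add: m_def algebra_simps)
qed

text \<open>The distance from a tangent ray to \<open>K\<close> is only known to be small at the times \<open>\<tau> i\<close>;
  the estimate on the segment from \<open>q0\<close> to \<open>k i\<close> makes it small at all earlier times.\<close>

lemma tangent_ray_near:
  assumes k: "\<And>i. k i \<in> K" and \<tau>: "\<And>i. 0 < \<tau> i" "\<tau> \<longlonglongrightarrow> 0"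
    and lim: "(\<lambda>i. (k i - q0) /\<^sub>R \<tau> i) \<longlonglongrightarrow> w" and "\<eta> > 0"
  shows "\<exists>d>0. \<forall>s\<in>{0..d}. norm (q0 + s *\<^sub>R w - P (q0 + s *\<^sub>R w)) \<le> \<eta> * s"
proof -
  have \<tau>1: "\<tau> i * inverse (\<tau> i) = 1" for i using \<tau>(1)[of i] by simp
  have "(\<lambda>i. \<tau> i *\<^sub>R ((k i - q0) /\<^sub>R \<tau> i)) \<longlonglongrightarrow> 0 *\<^sub>R w" by (intro tendsto_intros \<tau> lim)
  moreover have "(\<lambda>i. \<tau> i *\<^sub>R ((k i - q0) /\<^sub>R \<tau> i)) = (\<lambda>i. k i - q0)"
    by (simp add: \<tau>1)
  ultimately have "(\<lambda>i. k i - q0) \<longlonglongrightarrow> 0" by simp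
  then have 1: "\<forall>\<^sub>F i in sequentially. norm (k i - q0) < \<rho>"
    using \<rho>_pos by (simp add: tendsto_iff)
  have 2: "\<forall>\<^sub>F i in sequentially. norm ((k i - q0) /\<^sub>R \<tau> i - w) < \<eta> / 2"
    using tendstoD[OF lim, of "\<eta> / 2"] \<open>\<eta> > 0\<close> by (simp add: dist_norm)
  \<comment> \<open>With l = s / \<tau> the bound of \<open>segment_near\<close> is s times this
    product, a convergent factor times one that tends to 0.\<close>
  have "(\<lambda>i. 2 * \<sigma> * norm ((k i - q0) /\<^sub>R \<tau> i) * norm (k i - q0)) \<longlonglongrightarrow> 2 * \<sigma> * norm w * norm (0::'e)"
    by (intro tendsto_intros lim \<open>(\<lambda>i. k i - q0) \<longlonglongrightarrow> 0\<close>)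
  then have 3: "\<forall>\<^sub>F i in sequentially. 2 * \<sigma> * norm ((k i - q0) /\<^sub>R \<tau> i) * norm (k i - q0) < \<eta> / 2"
    using \<open>\<eta> > 0\<close> by (intro order_tendstoD) auto
  obtain i where i: "norm (k i - q0) < \<rho>" "norm ((k i - q0) /\<^sub>R \<tau> i - w) < \<eta> / 2"
    "2 * \<sigma> * norm ((k i - q0) /\<^sub>R \<tau> i) * norm (k i - q0) < \<eta> / 2"
    using eventually_happens'[OF sequentially_bot eventually_conj[OF 1 eventually_conj[OF 2 3]]] by blast
  show ?thesis
  \<comment> \<open>One good index suffices: all times up to \<open>\<tau> i\<close> are compared
    with the single chord from \<open>q0\<close> to \<open>k i\<close>. The error splits evenly into
    ray to chord (the direction error) and chord to \<open>K\<close>.\<close>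
  proof (intro exI[of _ "\<tau> i"] conjI ballI \<tau>)
    fix s assume s: "s \<in> {0..\<tau> i}"
    define l where "l = s / \<tau> i"
    have l: "0 \<le> l" "l \<le> 1" using s \<tau>(1)[of i] by (auto simp: l_def)
    define m where "m = q0 + l *\<^sub>R (k i - q0)"
    have seg: "norm (m - P m) \<le> 2 * \<sigma> * l * (norm (k i - q0))\<^sup>2"
      unfolding m_def by (rule segment_near[OF k i(1) l])
    also have "\<dots> = s * (2 * \<sigma> * norm ((k i - q0) /\<^sub>R \<tau> i) * norm (k i - q0))"
    proof -
      have "norm ((k i - q0) /\<^sub>R \<tau> i) = norm (k i - q0) / \<tau> i"
        using \<tau>(1)[of i] by (simp add: divide_inverse mult.commute)
      then show ?thesis by (simp only: l_def power2_eq_square) simp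
    qed
    also have "\<dots> \<le> s * (\<eta> / 2)" using s i(3) by (intro mult_left_mono) auto
    finally have A: "norm (m - P m) \<le> s * (\<eta> / 2)" .
    have "q0 + s *\<^sub>R w - m = s *\<^sub>R (w - (k i - q0) /\<^sub>R \<tau> i)"
      using \<tau>(1)[of i] by (simp add: m_def l_def algebra_simps divide_inverse)
    then have "norm (q0 + s *\<^sub>R w - m) = s * norm ((k i - q0) /\<^sub>R \<tau> i - w)"
      using s by (simp add: norm_minus_commute)
    also have "\<dots> \<le> s * (\<eta> / 2)" using s i(2) by (intro mult_left_mono) auto
    finally have B: "norm (q0 + s *\<^sub>R w - m) \<le> s * (\<eta> / 2)" .
    have "norm (q0 + s *\<^sub>R w - P (q0 + s *\<^sub>R w)) \<le> norm (q0 + s *\<^sub>R w - P m)"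
      by (rule norm_P_le[OF P_in])
    also have "\<dots> \<le> norm (q0 + s *\<^sub>R w - m) + norm (m - P m)"
      using norm_triangle_ineq[of "q0 + s *\<^sub>R w - m" "m - P m"] by simp
    also have "\<dots> \<le> \<eta> * s" using A B by (simp add: algebra_simps)
    finally show "norm (q0 + s *\<^sub>R w - P (q0 + s *\<^sub>R w)) \<le> \<eta> * s" .
  qed
qed

text \<open>The remainder \<beta>(t) - \<beta>(0) - t w is minus the displacement of q0 + t w from
  its nearest point, so \<open>tangent_ray_near\<close> is literally differentiability at 0.
  Continuity at the other times comes from \<open>P_lipschitz\<close>.\<close>

lemma proximal_curve:
  assumes k: "\<And>i. k i \<in> K" and \<tau>: "\<And>i. 0 < \<tau> i" "\<tau> \<longlonglongrightarrow> 0"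
    and lim: "(\<lambda>i. (k i - q0) /\<^sub>R \<tau> i) \<longlonglongrightarrow> w"
  obtains \<epsilon> \<beta> where "\<epsilon> > 0" "continuous_on {0..<\<epsilon>} \<beta>" "\<beta> ` {0..<\<epsilon>} \<subseteq> K" "\<beta> 0 = q0"
    "(\<beta> has_vector_derivative w) (at (0::real) within {0..<\<epsilon>})"
proof
  define \<beta> where "\<beta> t = P (q0 + t *\<^sub>R w)" for t
  \<comment> \<open>Keeps the ray in the ball of radius \<rho>, where \<open>P\<close> is Lipschitz;
    the summand 1 covers w = 0.\<close>
  define \<epsilon> where "\<epsilon> = \<rho> / (norm w + 1)"
  show pos: "\<epsilon> > 0" using \<rho>_pos by (simp add: \<epsilon>_def add_nonneg_pos)
  have near: "norm (t *\<^sub>R w) < \<rho>" if "t \<in> {0..<\<epsilon>}" for t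
  proof -
    have "t * norm w \<le> t * (norm w + 1)" using that by (intro mult_left_mono) auto
    also have "\<dots> < \<rho>" using that by (simp add: \<epsilon>_def pos_less_divide_eq add_nonneg_pos)
    finally show ?thesis using that by simp
  qed
  have "norm (\<beta> s - \<beta> t) \<le> 2 * norm w * norm (s - t)" if "s \<in> {0..<\<epsilon>}" "t \<in> {0..<\<epsilon>}" for s t
  proof -
    have "norm (\<beta> s - \<beta> t) \<le> 2 * norm ((q0 + s *\<^sub>R w) - (q0 + t *\<^sub>R w))"
      unfolding \<beta>_def by (rule P_lipschitz) (use near that in auto)
    also have "(q0 + s *\<^sub>R w) - (q0 + t *\<^sub>R w) = (s - t) *\<^sub>R w" by (simp add: algebra_simps)
    finally show ?thesis by (simp add: mult.commute mult.left_commute)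
  qed
  then have "(2 * norm w)-lipschitz_on {0..<\<epsilon>} \<beta>"
    by (intro lipschitz_onI) (auto simp: dist_norm)
  then show "continuous_on {0..<\<epsilon>} \<beta>" by (rule lipschitz_on_continuous_on)
  show "\<beta> ` {0..<\<epsilon>} \<subseteq> K" using P_in by (auto simp: \<beta>_def)
  show \<beta>0: "\<beta> 0 = q0" using P_self[OF q0_K] by (simp add: \<beta>_def)
  show "(\<beta> has_vector_derivative w) (at 0 within {0..<\<epsilon>})"
    unfolding has_vector_derivative_def has_derivative_within_alt
  proof (intro conjI allI impI)
    show "bounded_linear (\<lambda>x::real. x *\<^sub>R w)" by (rule bounded_linear_scaleR_left)
    fix e :: real assume "e > 0"
    from tangent_ray_near[OF k \<tau> lim this] obtain d where
      d: "d > 0" "\<forall>s\<in>{0..d}. norm (q0 + s *\<^sub>R w - P (q0 + s *\<^sub>R w)) \<le> e * s" by blast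
    show "\<exists>d>0. \<forall>y\<in>{0..<\<epsilon>}. norm (y - 0) < d \<longrightarrow>
        norm (\<beta> y - \<beta> 0 - (y - 0) *\<^sub>R w) \<le> e * norm (y - 0)"
    proof (intro exI[of _ d] conjI ballI impI d)
      fix y assume "y \<in> {0..<\<epsilon>}" "norm (y - 0) < d"
      then have "norm (q0 + y *\<^sub>R w - P (q0 + y *\<^sub>R w)) \<le> e * y" using d(2) by auto
      moreover have "\<beta> y - \<beta> 0 - (y - 0) *\<^sub>R w = - (q0 + y *\<^sub>R w - P (q0 + y *\<^sub>R w))"
        unfolding \<beta>0 by (simp add: \<beta>_def)
      ultimately show "norm (\<beta> y - \<beta> 0 - (y - 0) *\<^sub>R w) \<le> e * norm (y - 0)"
        using \<open>y \<in> {0..<\<epsilon>}\<close> by (simp only: norm_minus_cancel) simp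
    qed
  qed
qed

end

section \<open>Tangent vectors and metric coefficients in a chart\<close>

lemma smooth_on_imp_differentiable:
  "smooth_on f X \<Longrightarrow> x \<in> X \<Longrightarrow> f differentiable (at x)"
  unfolding smooth_on_def by (metis Ck_on.simps(2))

locale riemannian =
  fixes A :: "('m::{t2_space, second_countable_topology}, 'e::euclidean_space) chart set"
    and g :: "('m, 'e) metric"
  assumes manifold: "riemannian_manifold A g"
begin

abbreviation TS :: "'m \<Rightarrow> ('m, 'e) tvec set" where "TS \<equiv> tangent_space A"
abbreviation dom :: "('m, 'e) chart \<Rightarrow> 'e set" where "dom c \<equiv> snd c ` fst c"

lemma atlas: "smooth_atlas A" and metric: "riemannian_metric A g"
  using manifold by (auto simp: riemannian_manifold_def)

lemma chart_props:
  assumes "c \<in> A"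
  shows open_fst: "open (fst c)" and open_dom: "open (dom c)"
    and chart_homeo: "homeomorphism (fst c) (dom c) (snd c) (chart_inv c)"
  using bspec[OF conjunct1[OF conjunct2[OF atlas[unfolded smooth_atlas_def]]] assms] by blast+

lemma trans_smooth:
  assumes "c \<in> A" "c' \<in> A"
  shows "smooth_on (snd c' \<circ> chart_inv c) (snd c ` (fst c \<inter> fst c'))"
  using conjunct2[OF conjunct2[OF atlas[unfolded smooth_atlas_def]]] assms by blast

lemma ex_chart: "\<exists>c\<in>A. p \<in> fst c"
  using conjunct1[OF atlas[unfolded smooth_atlas_def]] by blast

lemma inv_snd [simp]: "c \<in> A \<Longrightarrow> p \<in> fst c \<Longrightarrow> chart_inv c (snd c p) = p"
  and snd_inv [simp]: "c \<in> A \<Longrightarrow> q \<in> dom c \<Longrightarrow> snd c (chart_inv c q) = q"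
  and inv_in [simp]: "c \<in> A \<Longrightarrow> q \<in> dom c \<Longrightarrow> chart_inv c q \<in> fst c"
  using chart_homeo unfolding homeomorphism_def by (auto intro!: inv_into_into f_inv_into_f)

lemma continuous_chart: "c \<in> A \<Longrightarrow> continuous_on (fst c) (snd c)"
  and continuous_inv: "c \<in> A \<Longrightarrow> continuous_on (dom c) (chart_inv c)"
  using chart_homeo by (auto simp: homeomorphism_def)

lemma isCont_chart: "c \<in> A \<Longrightarrow> p \<in> fst c \<Longrightarrow> isCont (snd c) p"
  using continuous_chart open_fst continuous_on_eq_continuous_at by blast

lemma isCont_inv: "c \<in> A \<Longrightarrow> q \<in> dom c \<Longrightarrow> isCont (chart_inv c) q"
  using continuous_inv open_dom continuous_on_eq_continuous_at by blast

lemma open_overlap: 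
  assumes "c \<in> A" "c' \<in> A"
  shows "open (snd c ` (fst c \<inter> fst c'))"
proof -
  have "open (dom c \<inter> chart_inv c -` fst c')"
    using continuous_on_open_vimage[OF open_dom] continuous_inv open_fst assms
    by (metis Int_commute)
  moreover have "dom c \<inter> chart_inv c -` fst c' = snd c ` (fst c \<inter> fst c')"
    using assms by auto
  ultimately show ?thesis by simp
qed

lemma has_derivative_trans:
  assumes "c \<in> A" "c' \<in> A" "p \<in> fst c" "p \<in> fst c'"
  shows "(snd c' \<circ> chart_inv c has_derivative trans_deriv c c' p) (at (snd c p))"
  using smooth_on_imp_differentiable[OF trans_smooth[OF assms(1,2)], of "snd c p"] assms(3,4)
  by (auto simp: trans_deriv_def frechet_derivative_works[symmetric])

lemma bounded_linear_trans:
  "\<lbrakk>c \<in> A; c' \<in> A; p \<in> fst c; p \<in> fst c'\<rbrakk> \<Longrightarrow> bounded_linear (trans_deriv c c' p)"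
  using has_derivative_trans has_derivative_bounded_linear by blast

lemma trans_deriv_self:
  assumes "c \<in> A" "p \<in> fst c"
  shows "trans_deriv c c p = (\<lambda>e. e)"
proof -
  have "((\<lambda>x. x) has_derivative (\<lambda>e. e)) (at (snd c p))" by (rule has_derivative_ident)
  then have "(snd c \<circ> chart_inv c has_derivative (\<lambda>e. e)) (at (snd c p))"
    by (rule has_derivative_transform_within_open[OF _ open_dom[OF assms(1)]]) (use assms in auto)
  then show ?thesis using has_derivative_trans[OF assms(1) assms(1) assms(2) assms(2)]
      has_derivative_unique by blast
qed

text \<open>Transition maps compose on the overlap, which is open, so the chain rule and uniqueness
  of derivatives give the cocycle identity. It is what makes \<open>coord_vec\<close> compatible
  between charts.\<close>

lemma trans_deriv_chain:
  assumes "c \<in> A" "c' \<in> A" "c'' \<in> A" "p \<in> fst c" "p \<in> fst c'" "p \<in> fst c''"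
  shows "trans_deriv c' c'' p (trans_deriv c c' p e) = trans_deriv c c'' p e"
proof -
  have "(snd c'' \<circ> chart_inv c' has_derivative trans_deriv c' c'' p) (at ((snd c' \<circ> chart_inv c) (snd c p)))"
    using has_derivative_trans[of c' c'' p] assms by simp
  from diff_chain_at[OF has_derivative_trans[OF assms(1,2,4,5)] this]
  have "((snd c'' \<circ> chart_inv c') \<circ> (snd c' \<circ> chart_inv c) has_derivative
      trans_deriv c' c'' p \<circ> trans_deriv c c' p) (at (snd c p))" .
  then have "(snd c'' \<circ> chart_inv c has_derivative trans_deriv c' c'' p \<circ> trans_deriv c c' p) (at (snd c p))"
    by (rule has_derivative_transform_within_open[OF _ open_overlap[of c c']]) (use assms in auto)
  then have "trans_deriv c' c'' p \<circ> trans_deriv c c' p = trans_deriv c c'' p"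
    using has_derivative_trans[of c c'' p] assms has_derivative_unique by blast
  then show ?thesis by (metis comp_apply)
qed

lemma coord_vec_in:
  assumes "c \<in> A" "p \<in> fst c"
  shows "coord_vec A c p e \<in> TS p"
proof -
  show "coord_vec A c p e \<in> TS p"
    unfolding tangent_space_def mem_Collect_eq
  proof (intro conjI ballI allI impI)
    fix c' c'' assume *: "c' \<in> A" "c'' \<in> A" "p \<in> fst c' \<and> p \<in> fst c''"
    show "coord_vec A c p e c'' = trans_deriv c' c'' p (coord_vec A c p e c')"
      unfolding coord_vec_def using * trans_deriv_chain[OF assms(1) *(1,2) assms(2), of e] by simp
  qed (auto simp: coord_vec_def)
qed

lemma coord_vec_self [simp]:
  assumes "c \<in> A" "p \<in> fst c"
  shows "coord_vec A c p e c = e"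
  using assms by (simp add: coord_vec_def trans_deriv_self)

text \<open>One chart determines a tangent vector. This lets all later estimates run in a single
  fixed chart.\<close>

lemma tangent_eq_coord_vec:
  assumes "c \<in> A" "p \<in> fst c" "v \<in> TS p"
  shows "coord_vec A c p (v c) = v"
proof
  fix c'
  show "coord_vec A c p (v c) c' = v c'"
  proof (cases "c' \<in> A \<and> p \<in> fst c'")
    case True
    then have "v c' = trans_deriv c c' p (v c)"
      using assms unfolding tangent_space_def mem_Collect_eq by blast
    then show ?thesis using True by (simp only: coord_vec_def) simp
  next
    case False
    then have "v c' = 0" using assms(3) unfolding tangent_space_def mem_Collect_eq by blast
    then show ?thesis using False by (simp only: coord_vec_def if_False)
  qed
qed

lemma coord_vec_add:
  assumes "c \<in> A" "p \<in> fst c"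
  shows "coord_vec A c p (e + e') = (\<lambda>d. coord_vec A c p e d + coord_vec A c p e' d)"
  using bounded_linear_trans[OF assms(1) _ assms(2)]
  by (auto simp: coord_vec_def fun_eq_iff bounded_linear.linear linear_add)

lemma coord_vec_scaleR:
  assumes "c \<in> A" "p \<in> fst c"
  shows "coord_vec A c p (r *\<^sub>R e) = (\<lambda>d. r *\<^sub>R coord_vec A c p e d)"
  using bounded_linear_trans[OF assms(1) _ assms(2)]
  by (auto simp: coord_vec_def fun_eq_iff bounded_linear.linear linear_scale)

lemma metric_props:
  assumes "u \<in> TS p" "v \<in> TS p"
  shows "g p u v = g p v u" "w \<in> TS p \<Longrightarrow> g p (\<lambda>c. u c + v c) w = g p u w + g p v w"
    "g p (\<lambda>c. r *\<^sub>R u c) v = r * g p u v" "u \<noteq> (\<lambda>c. 0) \<Longrightarrow> g p u u > 0"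
proof -
  have "g p u v = g p v u \<and> (\<forall>w\<in>TS p. g p (\<lambda>c. u c + v c) w = g p u w + g p v w) \<and>
      (\<forall>r. g p (\<lambda>c. r *\<^sub>R u c) v = r * g p u v) \<and> (u \<noteq> (\<lambda>c. 0) \<longrightarrow> g p u u > 0)"
    using conjunct1[OF metric[unfolded riemannian_metric_def]] assms by blast
  then show "g p u v = g p v u" "w \<in> TS p \<Longrightarrow> g p (\<lambda>c. u c + v c) w = g p u w + g p v w"
    "g p (\<lambda>c. r *\<^sub>R u c) v = r * g p u v" "u \<noteq> (\<lambda>c. 0) \<Longrightarrow> g p u u > 0" by blast+
qed

abbreviation G :: "('m, 'e) chart \<Rightarrow> 'e \<Rightarrow> 'e \<Rightarrow> 'e \<Rightarrow> real" where
  "G c q e e' \<equiv> metric_coeff A g c e e' q"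

lemma g_eq_G:
  assumes "c \<in> A" "p \<in> fst c" "u \<in> TS p" "v \<in> TS p"
  shows "g p u v = G c (snd c p) (u c) (v c)"
  using assms by (simp add: metric_coeff_def tangent_eq_coord_vec)

lemma
  assumes "c \<in> A" "q \<in> dom c"
  shows G_sym: "G c q e e' = G c q e' e"
    and G_add_left: "G c q (e + e') e'' = G c q e e'' + G c q e' e''"
    and G_scaleR_left: "G c q (r *\<^sub>R e) e' = r * G c q e e'"
    and G_pos: "e \<noteq> 0 \<Longrightarrow> G c q e e > 0"
proof -
  let ?p = "chart_inv c q"
  have p: "?p \<in> fst c" using assms by simp
  have T: "coord_vec A c ?p e \<in> TS ?p" for e by (rule coord_vec_in[OF assms(1) p])
  show "G c q e e' = G c q e' e"
    unfolding metric_coeff_def Let_def by (rule metric_props(1)[OF T T])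
  show "G c q (e + e') e'' = G c q e e'' + G c q e' e''"
    unfolding metric_coeff_def Let_def coord_vec_add[OF assms(1) p] by (rule metric_props(2)[OF T T T])
  show "G c q (r *\<^sub>R e) e' = r * G c q e e'"
    unfolding metric_coeff_def Let_def coord_vec_scaleR[OF assms(1) p] by (rule metric_props(3)[OF T T])
  show "G c q e e > 0" if "e \<noteq> 0"
  proof -
    have "coord_vec A c ?p e \<noteq> (\<lambda>c. 0)"
    proof
      assume "coord_vec A c ?p e = (\<lambda>c. 0)"
      then have "coord_vec A c ?p e c = 0" by (rule fun_cong)
      then show False using that assms(1) p by (simp only: coord_vec_self)
    qed
    then show ?thesis
      unfolding metric_coeff_def Let_def by (rule metric_props(4)[OF T T])
  qed
qed

lemma
  assumes "c \<in> A" "q \<in> dom c"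
  shows G_add_right: "G c q e (e' + e'') = G c q e e' + G c q e e''"
    and G_scaleR_right: "G c q e (r *\<^sub>R e') = r * G c q e e'"
  using G_sym[OF assms, of e] by (simp_all add: G_add_left[OF assms] G_scaleR_left[OF assms])

lemma bilinear_G: "c \<in> A \<Longrightarrow> q \<in> dom c \<Longrightarrow> bilinear (G c q)"
  unfolding bilinear_def
  by (intro conjI allI linearI) (simp_all add: G_add_left G_scaleR_left G_add_right G_scaleR_right)

lemma smooth_G: "c \<in> A \<Longrightarrow> smooth_on (\<lambda>q. G c q e e') (dom c)"
  using conjunct2[OF metric[unfolded riemannian_metric_def]] by blast

end

section \<open>Continuous families of bilinear forms\<close>

text \<open>Smoothness of the metric is given for each fixed pair of vectors. Through the finitely
  many basis entries it becomes regularity jointly in the point and in the vectors.\<close>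

lemma bilinear_expansion:
  fixes f :: "'e::euclidean_space \<Rightarrow> 'e \<Rightarrow> real"
  assumes "bilinear f"
  shows "f x y = (\<Sum>i\<in>Basis. \<Sum>j\<in>Basis. (x \<bullet> i) * (y \<bullet> j) * f i j)"
proof -
  have l: "linear (\<lambda>x. f x y)" "linear (f x)" for x y
    using assms by (auto simp: bilinear_def)
  have "f x y = f (\<Sum>i\<in>Basis. (x \<bullet> i) *\<^sub>R i) y" by (simp add: euclidean_representation)
  also have "\<dots> = (\<Sum>i\<in>Basis. (x \<bullet> i) * f i y)"
    by (simp add: linear_sum[OF l(1)] linear_scale[OF l(1)])
  also have "\<dots> = (\<Sum>i\<in>Basis. (x \<bullet> i) * (\<Sum>j\<in>Basis. (y \<bullet> j) * f i j))"
  proof (intro sum.cong refl arg_cong2[where f="(*)"])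
    fix i
    have "f i y = f i (\<Sum>j\<in>Basis. (y \<bullet> j) *\<^sub>R j)" by (simp add: euclidean_representation)
    also have "\<dots> = (\<Sum>j\<in>Basis. (y \<bullet> j) * f i j)"
      by (simp add: linear_sum[OF l(2)] linear_scale[OF l(2)])
    finally show "f i y = (\<Sum>j\<in>Basis. (y \<bullet> j) * f i j)" .
  qed
  finally show ?thesis by (simp add: sum_distrib_left mult.assoc)
qed

lemma bilinear_uniform_bound:
  fixes B :: "'a::topological_space \<Rightarrow> 'e::euclidean_space \<Rightarrow> 'e \<Rightarrow> real"
  assumes Q: "compact Q" and bil: "\<And>q. q \<in> Q \<Longrightarrow> bilinear (B q)"
    and cont: "\<And>u v. continuous_on Q (\<lambda>q. B q u v)"
  shows "\<exists>M\<ge>0. \<forall>q\<in>Q. \<forall>u v. \<bar>B q u v\<bar> \<le> M * norm u * norm v"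
proof -
  have "\<exists>M. \<forall>q\<in>Q. \<bar>B q i j\<bar> \<le> M" for i j
    using compact_imp_bounded[OF compact_continuous_image[OF cont Q]]
    by (auto simp: bounded_iff)
  then obtain m where m: "\<And>i j q. q \<in> Q \<Longrightarrow> \<bar>B q i j\<bar> \<le> m i j" by metis
  define M where "M = (\<Sum>i\<in>(Basis::'e set). \<Sum>j\<in>(Basis::'e set). \<bar>m i j\<bar>)"
  have "\<bar>B q u v\<bar> \<le> M * norm u * norm v" if q: "q \<in> Q" for q u v
  proof -
    have "\<bar>B q u v\<bar> \<le> (\<Sum>i\<in>Basis. \<Sum>j\<in>Basis. \<bar>(u \<bullet> i) * (v \<bullet> j) * B q i j\<bar>)"
      unfolding bilinear_expansion[OF bil[OF q], of u v]
      by (rule order_trans[OF sum_abs]) (intro sum_mono sum_abs)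
    also have "\<dots> \<le> (\<Sum>i\<in>(Basis::'e set). \<Sum>j\<in>(Basis::'e set). (norm u * norm v) * \<bar>m i j\<bar>)"
    proof (intro sum_mono)
      fix i j :: 'e assume "i \<in> Basis" "j \<in> Basis"
      then have "\<bar>u \<bullet> i\<bar> * \<bar>v \<bullet> j\<bar> \<le> norm u * norm v"
        by (intro mult_mono Basis_le_norm) auto
      then show "\<bar>(u \<bullet> i) * (v \<bullet> j) * B q i j\<bar> \<le> (norm u * norm v) * \<bar>m i j\<bar>"
        unfolding abs_mult using m[OF q, of i j] by (intro mult_mono[of "\<bar>u \<bullet> i\<bar> * \<bar>v \<bullet> j\<bar>"]) auto
    qed
    also have "\<dots> = M * norm u * norm v"
      by (simp add: M_def sum_distrib_left[symmetric] mult_ac)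
    finally show ?thesis .
  qed
  moreover have "M \<ge> 0" by (auto simp: M_def intro!: sum_nonneg)
  ultimately show ?thesis by blast
qed

text \<open>The constant is the minimum of B q u u over the compact set of pairs of a point of
  \<open>Q\<close> and a unit vector; it is attained, hence positive, and homogeneity extends the
  bound to all vectors.\<close>

lemma bilinear_uniform_coercive:
  fixes B :: "'a::topological_space \<Rightarrow> 'e::euclidean_space \<Rightarrow> 'e \<Rightarrow> real"
  assumes Q: "compact Q" and bil: "\<And>q. q \<in> Q \<Longrightarrow> bilinear (B q)"
    and cont: "\<And>u v. continuous_on Q (\<lambda>q. B q u v)"
    and pos: "\<And>q u. q \<in> Q \<Longrightarrow> u \<noteq> 0 \<Longrightarrow> B q u u > 0"
  shows "\<exists>m>0. \<forall>q\<in>Q. \<forall>u. m * (norm u)\<^sup>2 \<le> B q u u"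
proof (cases "Q = {}")
  case True then show ?thesis by (intro exI[of _ 1]) auto
next
  case False
  \<comment> \<open>The expanded form, in which joint continuity in the point and the vector is
    visible.\<close>
  let ?F = "\<lambda>x. \<Sum>i\<in>Basis. \<Sum>j\<in>Basis. (snd x \<bullet> i) * (snd x \<bullet> j) * B (fst x) i j"
  have F: "?F (q, u) = B q u u" if "q \<in> Q" for q u
    using bilinear_expansion[OF bil[OF that], of u u] by simp
  have "continuous_on (Q \<times> sphere 0 1) ?F"
    by (intro continuous_intros continuous_on_compose2[OF cont continuous_on_fst[OF continuous_on_id]]) auto
  moreover have "compact (Q \<times> sphere (0::'e) 1)" by (intro compact_Times Q compact_sphere)
  moreover have "Q \<times> sphere (0::'e) 1 \<noteq> {}" using False by simp
  ultimately obtain x where x: "x \<in> Q \<times> sphere (0::'e) 1" "\<forall>y\<in>Q \<times> sphere 0 1. ?F x \<le> ?F y"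
    using continuous_attains_inf[of "Q \<times> sphere 0 1" ?F] by blast
  obtain q0 u0 where qu: "x = (q0, u0)" "q0 \<in> Q" "norm u0 = 1" using x(1) by auto
  define m where "m = B q0 u0 u0"
  have "m > 0" unfolding m_def by (rule pos) (use qu in auto)
  moreover have "m * (norm u)\<^sup>2 \<le> B q u u" if q: "q \<in> Q" for q u
  proof (cases "u = 0")
    case True
    then show ?thesis using bilinear_lzero[OF bil[OF q]] by simp
  next
    case False
    define w where "w = u /\<^sub>R norm u"
    have u: "u = norm u *\<^sub>R w" using False by (simp add: w_def)
    have "(q, w) \<in> Q \<times> sphere 0 1" using q False by (auto simp: w_def)
    with x(2) have "?F x \<le> ?F (q, w)" by (rule bspec)
    then have "m \<le> B q w w" unfolding m_def qu(1) F[OF q] F[OF qu(2)] .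
    then have "m * (norm u)\<^sup>2 \<le> B q w w * (norm u)\<^sup>2" by (rule mult_right_mono) auto
    also have "\<dots> = B q (norm u *\<^sub>R w) (norm u *\<^sub>R w)"
      by (simp add: bilinear_lmul[OF bil[OF q]] bilinear_rmul[OF bil[OF q]] power2_eq_square)
    finally show ?thesis using u by simp
  qed
  ultimately show ?thesis by blast
qed

text \<open>Evaluation on the basis is a linear endomorphism \<open>T\<close>; positivity makes it
  injective, hence surjective in finite dimension. The lemma justifies the definite description in
  \<open>christoffel\<close> and turns Euclidean normals into tangent vectors.\<close>

lemma bilinear_riesz:
  fixes B :: "'e::euclidean_space \<Rightarrow> 'e \<Rightarrow> real"
  assumes bil: "bilinear B" and pos: "\<And>u. u \<noteq> 0 \<Longrightarrow> B u u > 0" and l: "linear l"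
  shows "\<exists>!k. \<forall>w. B k w = l w"
proof (rule ex_ex1I)
  have lin: "linear (\<lambda>x. B x y)" "linear (B x)" for x y using bil by (auto simp: bilinear_def)
  define T where "T k = (\<Sum>i\<in>Basis. B k i *\<^sub>R i)" for k
  have Ti: "T k \<bullet> i = B k i" if "i \<in> Basis" for k i
    using that by (simp add: T_def inner_sum_left inner_Basis if_distrib sum.delta cong: if_cong)
  have linT: "linear T"
    by (rule linearI)
       (simp_all add: T_def linear_add[OF lin(1)] linear_scale[OF lin(1)] scaleR_left_distrib sum.distrib
         scaleR_sum_right)
  have ext: "(\<forall>w. B k w = f w)" if "linear f" "\<forall>i\<in>Basis. B k i = f i" for f k
    using linear_eq_stdbasis[OF lin(2) that(1)] that(2) by (metis)
  have "inj T"
    unfolding linear_injective_0[OF linT]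
  proof (intro allI impI)
    fix k assume "T k = 0"
    then have "\<forall>i\<in>Basis. B k i = 0" using Ti[of _ k] by (metis inner_zero_left)
    then have "B k k = 0" using ext[of "\<lambda>_. 0" k] by (auto simp: linear_iff)
    then show "k = 0" using pos[of k] by fastforce
  qed
  then have "surj T" using linear_injective_imp_surjective[OF linT] by blast
  then obtain k where k: "T k = (\<Sum>i\<in>Basis. l i *\<^sub>R i)" by (metis surjD)
  have "B k i = l i" if "i \<in> Basis" for i
    using Ti[OF that, of k] that
    unfolding k by (simp add: inner_sum_left inner_Basis if_distrib sum.delta cong: if_cong)
  then show "\<exists>k. \<forall>w. B k w = l w" using ext[OF l] by blast
  show "k = k'" if "\<forall>w. B k w = l w" "\<forall>w. B k' w = l w" for k k'
  proof (rule ccontr)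
    assume "k \<noteq> k'"
    then have "B (k - k') (k - k') > 0" by (intro pos) simp
    then show False using that by (simp add: linear_diff[OF lin(1)])
  qed
qed

section \<open>Derivatives of the metric and Christoffel symbols\<close>

context riemannian
begin

abbreviation DG :: "('m, 'e) chart \<Rightarrow> 'e \<Rightarrow> 'e \<Rightarrow> 'e \<Rightarrow> 'e \<Rightarrow> real" where
  "DG c q a e e' \<equiv> frechet_derivative (\<lambda>q. G c q e e') (at q) a"

lemma has_derivative_G:
  "c \<in> A \<Longrightarrow> q \<in> dom c \<Longrightarrow> ((\<lambda>q. G c q e e') has_derivative (\<lambda>a. DG c q a e e')) (at q)"
  using smooth_on_imp_differentiable[OF smooth_G] by (simp only: frechet_derivative_works)

lemma continuous_on_G: "c \<in> A \<Longrightarrow> continuous_on (dom c) (\<lambda>q. G c q e e')"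
  using has_derivative_G by (meson continuous_at_imp_continuous_on has_derivative_continuous)

lemma continuous_on_DG: "c \<in> A \<Longrightarrow> continuous_on (dom c) (\<lambda>q. DG c q a e e')"
  using smooth_G[of c e e', unfolded smooth_on_def, THEN spec, of "Suc 0"] by simp

lemma linear_DG: "c \<in> A \<Longrightarrow> q \<in> dom c \<Longrightarrow> linear (\<lambda>a. DG c q a e e')"
  using has_derivative_G has_derivative_linear by blast

text \<open>Identities between the coefficients hold only at points of the chart image; since it is
  open, they pass to derivatives there. Symmetry and linearity of \<open>DG\<close> in the vectors
  follow this way.\<close>

lemma DG_eqI:
  assumes "c \<in> A" "q \<in> dom c" "\<And>q. q \<in> dom c \<Longrightarrow> f q = G c q e e'" "(f has_derivative f') (at q)"
  shows "DG c q a e e' = f' a"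
proof -
  have "((\<lambda>q. G c q e e') has_derivative f') (at q)"
    by (rule has_derivative_transform_within_open[OF assms(4) open_dom[OF assms(1)] assms(2,3)])
  then show ?thesis using frechet_derivative_at by metis
qed

lemma
  assumes "c \<in> A" "q \<in> dom c"
  shows DG_sym: "DG c q a e e' = DG c q a e' e"
    and DG_add_left: "DG c q a (e + e') e'' = DG c q a e e'' + DG c q a e' e''"
    and DG_scaleR_left: "DG c q a (r *\<^sub>R e) e' = r * DG c q a e e'"
proof -
  note D = has_derivative_G[OF assms]
  show "DG c q a e e' = DG c q a e' e"
    by (rule DG_eqI[OF assms G_sym[OF assms(1)] D])
  show "DG c q a (e + e') e'' = DG c q a e e'' + DG c q a e' e''"
    by (rule DG_eqI[OF assms G_add_left[OF assms(1), symmetric] has_derivative_add[OF D D]])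
  show "DG c q a (r *\<^sub>R e) e' = r * DG c q a e e'"
    by (rule DG_eqI[OF assms G_scaleR_left[OF assms(1), symmetric] has_derivative_mult_right[OF D]])
qed

lemma bilinear_DG:
  assumes "c \<in> A" "q \<in> dom c"
  shows "bilinear (DG c q a)"
proof -
  have "linear (\<lambda>e. DG c q a e e')" for e'
    by (rule linearI) (simp_all add: DG_add_left[OF assms] DG_scaleR_left[OF assms])
  moreover have "(\<lambda>e'. DG c q a e e') = (\<lambda>e'. DG c q a e' e)" for e
    by (rule ext) (rule DG_sym[OF assms])
  ultimately show ?thesis unfolding bilinear_def by metis
qed

text \<open>Product rule in the basis expansion \<open>F\<close>, where only coefficients with
  constant vectors are differentiated; the two terms containing w' coincide by symmetry.
  \<open>F\<close> agrees with the metric term only while \<open>u\<close> is in the chart image,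
  hence the transfer to nearby parameters at the end.\<close>

lemma has_vector_derivative_G:
  assumes c: "c \<in> A" "u t \<in> dom c" and "t \<in> T"
    and u: "(u has_vector_derivative u') (at t within T)"
    and w: "(w has_vector_derivative w') (at t within T)"
  shows "((\<lambda>s. G c (u s) (w s) (w s)) has_vector_derivative
     (DG c (u t) u' (w t) (w t) + 2 * G c (u t) w' (w t))) (at t within T)"
proof -
  define F where "F s = (\<Sum>i\<in>Basis. \<Sum>j\<in>Basis. (w s \<bullet> i) * (w s \<bullet> j) * G c (u s) i j)" for s
  let ?F' = "\<Sum>i\<in>Basis. \<Sum>j\<in>Basis. (w t \<bullet> i) * (w t \<bullet> j) * DG c (u t) u' i j +
     ((w t \<bullet> i) * (w' \<bullet> j) + (w' \<bullet> i) * (w t \<bullet> j)) * G c (u t) i j"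
  have Gu: "((\<lambda>s. G c (u s) i j) has_vector_derivative DG c (u t) u' i j) (at t within T)" for i j
  proof -
    have "((\<lambda>q. G c q i j) \<circ> u has_derivative (\<lambda>a. DG c (u t) a i j) \<circ> (\<lambda>h. h *\<^sub>R u')) (at t within T)"
      using u[unfolded has_vector_derivative_def] has_derivative_G[OF c, of i j, THEN has_derivative_at_withinI]
      by (rule diff_chain_within)
    then show ?thesis
      unfolding has_vector_derivative_def comp_def
      by (simp add: linear_scale[OF linear_DG[OF c]])
  qed
  have "(F has_vector_derivative ?F') (at t within T)"
    unfolding F_def
    by (intro has_vector_derivative_sum has_vector_derivative_mult Gu
        bounded_linear.has_vector_derivative[OF bounded_linear_inner_left w])
  moreover have "?F' = DG c (u t) u' (w t) (w t) + (G c (u t) (w t) w' + G c (u t) w' (w t))"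
  proof -
    have "DG c (u t) u' (w t) (w t) = (\<Sum>i\<in>Basis. \<Sum>j\<in>Basis. (w t \<bullet> i) * (w t \<bullet> j) * DG c (u t) u' i j)"
      by (rule bilinear_expansion[OF bilinear_DG[OF c]])
    moreover have "G c (u t) (w t) w' = (\<Sum>i\<in>Basis. \<Sum>j\<in>Basis. (w t \<bullet> i) * (w' \<bullet> j) * G c (u t) i j)"
      "G c (u t) w' (w t) = (\<Sum>i\<in>Basis. \<Sum>j\<in>Basis. (w' \<bullet> i) * (w t \<bullet> j) * G c (u t) i j)"
      by (rule bilinear_expansion[OF bilinear_G[OF c]])+
    ultimately show ?thesis by (simp only: sum.distrib distrib_right)
  qed
  moreover have "G c (u t) (w t) w' = G c (u t) w' (w t)" by (rule G_sym[OF c])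
  ultimately have F: "(F has_vector_derivative (DG c (u t) u' (w t) (w t) + 2 * G c (u t) w' (w t))) (at t within T)"
    by simp
  have "continuous (at t within T) u" using u has_vector_derivative_continuous by blast
  then have "\<forall>\<^sub>F s in at t within T. u s \<in> dom c"
    unfolding continuous_within by (rule topological_tendstoD[OF _ open_dom[OF c(1)] c(2)])
  then have ev: "\<forall>\<^sub>F s in at t within T. F s = G c (u s) (w s) (w s)"
    by eventually_elim (unfold F_def, rule bilinear_expansion[OF bilinear_G[OF c(1)], symmetric])
  have "F t = G c (u t) (w t) (w t)"
    unfolding F_def by (rule bilinear_expansion[OF bilinear_G[OF c], symmetric])
  from has_derivative_transform_eventually[OF F[unfolded has_vector_derivative_def] ev this \<open>t \<in> T\<close>]
  show ?thesis unfolding has_vector_derivative_def .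
qed

lemma ex_tangent_representer:
  assumes "c \<in> A" "q \<in> dom c" "linear l"
  shows "\<exists>!k. \<forall>w. G c q k w = l w"
  by (rule bilinear_riesz[OF bilinear_G[OF assms(1,2)] G_pos[OF assms(1,2)] assms(3)])

lemma G_christoffel:
  assumes c: "c \<in> A" "p \<in> fst c"
  defines "q \<equiv> snd c p"
  shows "G c q (christoffel A g c p u v) w = (DG c q u v w + DG c q v u w - DG c q w u v) / 2"
proof -
  have q: "q \<in> dom c" using c by (simp add: q_def)
  have "linear (\<lambda>w. (DG c q u v w + DG c q v u w - DG c q w u v) / 2)"
    using linear_DG[OF c(1) q, of u v] bilinear_DG[OF c(1) q, of u] bilinear_DG[OF c(1) q, of v]
    unfolding bilinear_def linear_iff by (simp add: field_simps)
  from theI'[OF ex_tangent_representer[OF c(1) q this]]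
  have "\<forall>w. G c q (christoffel A g c p u v) w = (DG c q u v w + DG c q v u w - DG c q w u v) / 2"
    unfolding christoffel_def Let_def q_def[symmetric] .
  then show ?thesis by (rule spec)
qed

end

section \<open>Bounds for the Christoffel symbols and speed of geodesics\<close>

context riemannian
begin

lemma DG_uniform_bound:
  assumes c: "c \<in> A" and Q: "compact Q" "Q \<subseteq> dom c"
  shows "\<exists>M\<ge>0. \<forall>q\<in>Q. \<forall>a u v. \<bar>DG c q a u v\<bar> \<le> M * norm a * norm u * norm v"
proof -
  have "\<exists>M\<ge>0. \<forall>q\<in>Q. \<forall>u v. \<bar>DG c q a u v\<bar> \<le> M * norm u * norm v" for a
    by (rule bilinear_uniform_bound[OF Q(1) bilinear_DG[OF c]])
       (use Q(2) continuous_on_subset[OF continuous_on_DG[OF c] Q(2)] in auto)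
  then obtain m where m: "\<And>a. m a \<ge> 0" "\<And>a q u v. q \<in> Q \<Longrightarrow> \<bar>DG c q a u v\<bar> \<le> m a * norm u * norm v"
    by metis
  define M where "M = (\<Sum>i\<in>Basis. m i)"
  have "\<bar>DG c q a u v\<bar> \<le> M * norm a * norm u * norm v" if q: "q \<in> Q" for q a u v
  proof -
    have lin: "linear (\<lambda>a. DG c q a u v)" by (rule linear_DG[OF c]) (use q Q in auto)
    have "DG c q a u v = DG c q (\<Sum>i\<in>Basis. (a \<bullet> i) *\<^sub>R i) u v" by (simp add: euclidean_representation)
    also have "\<dots> = (\<Sum>i\<in>Basis. (a \<bullet> i) * DG c q i u v)"
      by (simp add: linear_sum[OF lin] linear_scale[OF lin])
    finally have "\<bar>DG c q a u v\<bar> \<le> (\<Sum>i\<in>Basis. \<bar>(a \<bullet> i) * DG c q i u v\<bar>)"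
      by (simp only: sum_abs)
    also have "\<dots> \<le> (\<Sum>i\<in>Basis. norm a * (m i * norm u * norm v))"
      unfolding abs_mult by (intro sum_mono mult_mono m q Basis_le_norm) auto
    also have "\<dots> = M * norm a * norm u * norm v"
      by (simp add: M_def sum_distrib_left[symmetric] sum_distrib_right[symmetric] mult_ac)
    finally show ?thesis .
  qed
  moreover have "M \<ge> 0" unfolding M_def by (intro sum_nonneg m)
  ultimately show ?thesis by blast
qed

text \<open>Testing the defining identity of k = \<Gamma>(u,u) with w = k gives m |k|^2 \<le> (3/2)
  M |u|^2 |k|, and one factor |k| cancels.\<close>

lemma christoffel_uniform_bound:
  assumes c: "c \<in> A" and Q: "compact Q" "Q \<subseteq> dom c"
  shows "\<exists>M\<ge>0. \<forall>p\<in>fst c. snd c p \<in> Q \<longrightarrow> (\<forall>u. norm (christoffel A g c p u u) \<le> M * (norm u)\<^sup>2)"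
proof -
  obtain M where M: "M \<ge> 0" "\<And>q a u v. q \<in> Q \<Longrightarrow> \<bar>DG c q a u v\<bar> \<le> M * norm a * norm u * norm v"
    using DG_uniform_bound[OF assms] by blast
  have "\<exists>m>0. \<forall>q\<in>Q. \<forall>u. m * (norm u)\<^sup>2 \<le> G c q u u"
    by (rule bilinear_uniform_coercive[OF Q(1) bilinear_G[OF c] _ G_pos[OF c]])
       (use Q(2) continuous_on_subset[OF continuous_on_G[OF c] Q(2)] in auto)
  then obtain m where m: "m > 0" "\<And>q u. q \<in> Q \<Longrightarrow> m * (norm u)\<^sup>2 \<le> G c q u u" by blast
  have "norm (christoffel A g c p u u) \<le> 3 * M / (2 * m) * (norm u)\<^sup>2" if p: "p \<in> fst c" "snd c p \<in> Q" for p u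
  proof -
    let ?k = "christoffel A g c p u u" and ?q = "snd c p"
    have "m * (norm ?k)\<^sup>2 \<le> G c ?q ?k ?k" by (rule m(2)[OF p(2)])
    also have "\<dots> = (DG c ?q u u ?k + DG c ?q u u ?k - DG c ?q ?k u u) / 2"
      by (rule G_christoffel[OF c p(1)])
    also have "\<dots> \<le> 3 / 2 * (M * norm u * norm u * norm ?k)"
      using M(2)[OF p(2), where a=u and u=u and v="?k"] M(2)[OF p(2), where a="?k" and u=u and v=u] by (simp add: mult_ac)
    finally have "m * norm ?k * norm ?k \<le> (3 / 2 * M * norm u * norm u) * norm ?k"
      by (simp add: power2_eq_square mult_ac)
    then have "m * norm ?k \<le> 3 / 2 * M * norm u * norm u \<or> norm ?k = 0"
      by (auto simp: mult_le_cancel_right)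
    then show ?thesis
    proof
      assume "m * norm ?k \<le> 3 / 2 * M * norm u * norm u"
      then show ?thesis using m(1) by (simp add: field_simps power2_eq_square)
    next
      assume "norm ?k = 0"
      then show ?thesis using m(1) M(1) by simp
    qed
  qed
  moreover have "3 * M / (2 * m) \<ge> 0" using m(1) M(1) by simp
  ultimately show ?thesis by blast
qed

lemma velocity_eq:
  assumes "c \<in> A" "\<gamma> t \<in> fst c" "t \<in> {0..1}"
    "((\<lambda>s. snd c (\<gamma> s)) has_vector_derivative w) (at t within {0..1})"
  shows "velocity A \<gamma> {0..1} t c = w"
  using assms vector_derivative_within_cbox[of 0 1 t "\<lambda>s. snd c (\<gamma> s)" w]
  by (simp add: velocity_def)

lemma geodesicD:
  assumes "geodesic A g \<gamma>" "t \<in> {0..1}"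
  shows "velocity A \<gamma> {0..1} t \<in> TS (\<gamma> t)" "continuous (at t within {0..1}) \<gamma>"
    "\<lbrakk>c \<in> A; \<gamma> t \<in> fst c\<rbrakk> \<Longrightarrow>
      ((\<lambda>s. snd c (\<gamma> s)) has_vector_derivative velocity A \<gamma> {0..1} t c) (at t within {0..1})"
    "\<lbrakk>c \<in> A; \<gamma> t \<in> fst c\<rbrakk> \<Longrightarrow>
      ((\<lambda>s. velocity A \<gamma> {0..1} s c) has_vector_derivative
        - christoffel A g c (\<gamma> t) (velocity A \<gamma> {0..1} t c) (velocity A \<gamma> {0..1} t c)) (at t within {0..1})"
  using bspec[OF assms(1)[unfolded geodesic_def Let_def] assms(2), unfolded has_velocity_def] by blast+

text \<open>Pairing \<Gamma>(u,u) with u leaves half of the derivative of the metric in direction u,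
  so the geodesic equation cancels the variation of the metric along the curve. The squared speed
  does not depend on the chart; therefore a chart chosen separately at each time is enough, even for
  a geodesic that no chart contains.\<close>

lemma geodesic_speed_derivative:
  assumes \<gamma>: "geodesic A g \<gamma>" and t: "t \<in> {0..1}"
  shows "((\<lambda>s. g (\<gamma> s) (velocity A \<gamma> {0..1} s) (velocity A \<gamma> {0..1} s)) has_derivative (\<lambda>h. 0))
    (at t within {0..1})"
proof -
  obtain c where c: "c \<in> A" "\<gamma> t \<in> fst c" using ex_chart by blast
  let ?w = "\<lambda>s. velocity A \<gamma> {0..1} s c" and ?u = "\<lambda>s. snd c (\<gamma> s)"
  have q: "?u t \<in> dom c" using c by simp
  have "((\<lambda>s. G c (?u s) (?w s) (?w s)) has_vector_derivative
     (DG c (?u t) (?w t) (?w t) (?w t) + 2 * G c (?u t) (- christoffel A g c (\<gamma> t) (?w t) (?w t)) (?w t)))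
     (at t within {0..1})"
    by (rule has_vector_derivative_G[OF c(1) q t geodesicD(3,4)[OF \<gamma> t c]])
  moreover have "G c (?u t) (- christoffel A g c (\<gamma> t) (?w t) (?w t)) (?w t)
      = - (DG c (?u t) (?w t) (?w t) (?w t) / 2)"
    using G_scaleR_left[OF c(1) q, of "-1"] G_christoffel[OF c] by simp
  ultimately have D: "((\<lambda>s. G c (?u s) (?w s) (?w s)) has_derivative (\<lambda>h. 0)) (at t within {0..1})"
    by (simp add: has_vector_derivative_def)
  have "\<forall>\<^sub>F s in at t within {0..1}. \<gamma> s \<in> fst c"
    using geodesicD(2)[OF \<gamma> t] unfolding continuous_within
    by (rule topological_tendstoD[OF _ open_fst[OF c(1)] c(2)])
  moreover have "\<forall>\<^sub>F s in at t within {0..1}. s \<in> {0..1}" by (simp add: eventually_at_filter)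
  ultimately have "\<forall>\<^sub>F s in at t within {0..1}. G c (?u s) (?w s) (?w s)
      = g (\<gamma> s) (velocity A \<gamma> {0..1} s) (velocity A \<gamma> {0..1} s)"
    by eventually_elim (rule g_eq_G[OF c(1) _ geodesicD(1)[OF \<gamma>] geodesicD(1)[OF \<gamma>], symmetric])
  then show ?thesis
    by (rule has_derivative_transform_eventually[OF D])
       (rule g_eq_G[OF c geodesicD(1)[OF \<gamma> t] geodesicD(1)[OF \<gamma> t], symmetric], rule t)
qed

lemma geodesic_constant_speed:
  assumes "geodesic A g \<gamma>" "t \<in> {0..1}"
  shows "tnorm g (\<gamma> t) (velocity A \<gamma> {0..1} t) = tnorm g (\<gamma> 0) (velocity A \<gamma> {0..1} 0)"
proof -
  have "\<exists>k. \<forall>s\<in>{0..1}. g (\<gamma> s) (velocity A \<gamma> {0..1} s) (velocity A \<gamma> {0..1} s) = k"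
    using has_derivative_zero_constant[OF convex_closed_interval geodesic_speed_derivative[OF assms(1)]]
    by (metis (no_types, lifting))
  then show ?thesis using assms(2) unfolding tnorm_def by (metis atLeastAtMost_iff order_refl zero_le_one)
qed

text \<open>At constant speed on [0,1] the length is the initial speed. This replaces the extended
  real distance by the norm of \<open>exp_inv\<close>, a real number.\<close>

lemma minimizing_geodesic_rdist:
  assumes "minimizing_geodesic A g x y \<gamma>"
  shows "rdist A g x y = ereal (tnorm g x (velocity A \<gamma> {0..1} 0))"
proof -
  have \<gamma>: "geodesic A g \<gamma>" "\<gamma> 0 = x" "ereal (curve_length A g \<gamma>) = rdist A g x y"
    using assms by (auto simp: minimizing_geodesic_def)
  have "curve_length A g \<gamma> = integral {0..1} (\<lambda>t::real. tnorm g (\<gamma> 0) (velocity A \<gamma> {0..1} 0))"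
    unfolding curve_length_def by (rule integral_cong) (rule geodesic_constant_speed[OF \<gamma>(1)])
  then show ?thesis using \<gamma> by simp
qed

end

section \<open>Comparison with the Euclidean metric in a coordinate ball\<close>

text \<open>A single \<Lambda> serves both comparisons of norms and the Christoffel bound, so the
  powers of \<Lambda> below merely count uses of these bounds. The ball is closed so that
  compactness supplies \<Lambda>.\<close>

locale riemannian_chart = riemannian A g
  for A :: "('m::{t2_space, second_countable_topology}, 'e::euclidean_space) chart set"
    and g :: "('m, 'e) metric" +
  fixes c :: "('m, 'e) chart" and q0 :: 'e and R \<Lambda> :: real
  assumes c: "c \<in> A" and R_pos: "R > 0" and \<Lambda>_pos: "\<Lambda> > 0" and cball_dom: "cball q0 R \<subseteq> dom c"
    and norm_le: "\<And>q e. q \<in> cball q0 R \<Longrightarrow> norm e \<le> \<Lambda> * sqrt (G c q e e)"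
    and G_bound: "\<And>q e e'. q \<in> cball q0 R \<Longrightarrow> \<bar>G c q e e'\<bar> \<le> \<Lambda>\<^sup>2 * norm e * norm e'"
    and christoffel_bound: "\<And>p u. \<lbrakk>p \<in> fst c; snd c p \<in> cball q0 R\<rbrakk> \<Longrightarrow>
      norm (christoffel A g c p u u) \<le> \<Lambda> * (norm u)\<^sup>2"

lemma (in riemannian) ex_riemannian_chart:
  assumes c: "c \<in> A" "z \<in> fst c"
  shows "\<exists>R \<Lambda>. riemannian_chart A g c (snd c z) R \<Lambda>"
proof -
  obtain R where R: "R > 0" "cball (snd c z) R \<subseteq> dom c"
    using open_dom[OF c(1)] c(2) open_contains_cball by (metis imageI)
  let ?Q = "cball (snd c z) R"
  have Q: "\<And>q. q \<in> ?Q \<Longrightarrow> q \<in> dom c" using R(2) by blast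
  note contG = continuous_on_subset[OF continuous_on_G[OF c(1)] R(2)]
  obtain M1 where M1: "M1 \<ge> 0" "\<forall>q\<in>?Q. \<forall>u v. \<bar>G c q u v\<bar> \<le> M1 * norm u * norm v"
    using bilinear_uniform_bound[OF compact_cball bilinear_G[OF c(1) Q] contG] by blast
  obtain m where m: "m > 0" "\<forall>q\<in>?Q. \<forall>u. m * (norm u)\<^sup>2 \<le> G c q u u"
    using bilinear_uniform_coercive[OF compact_cball bilinear_G[OF c(1) Q] contG G_pos[OF c(1) Q]] by blast
  obtain M2 where M2: "M2 \<ge> 0" "\<forall>p\<in>fst c. snd c p \<in> ?Q \<longrightarrow> (\<forall>u. norm (christoffel A g c p u u) \<le> M2 * (norm u)\<^sup>2)"
    using christoffel_uniform_bound[OF c(1) compact_cball R(2)] by blast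
  \<comment> \<open>The summand 1 gives \<Lambda> \<ge> 1, so that M1 \<le> \<Lambda> implies M1
    \<le> \<Lambda>^2.\<close>
  define \<Lambda> where "\<Lambda> = 1 + M1 + M2 + 1 / sqrt m"
  have sm: "sqrt m > 0" using m(1) by simp
  have \<Lambda>: "\<Lambda> \<ge> 1" "\<Lambda> \<ge> M1" "\<Lambda> \<ge> M2" "\<Lambda> \<ge> 1 / sqrt m"
    using M1(1) M2(1) sm by (auto simp: \<Lambda>_def)
  have \<Lambda>2: "\<Lambda>\<^sup>2 \<ge> M1"
  proof -
    have "M1 \<le> \<Lambda> * 1" using \<Lambda> by simp
    also have "\<dots> \<le> \<Lambda> * \<Lambda>" using \<Lambda> by (intro mult_left_mono) auto
    finally show ?thesis by (simp add: power2_eq_square)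
  qed
  have "riemannian_chart A g c (snd c z) R \<Lambda>"
  proof unfold_locales
    show "c \<in> A" "R > 0" "\<Lambda> > 0" "?Q \<subseteq> dom c" using c R \<Lambda> by auto
    fix q e e' :: 'e assume q: "q \<in> ?Q"
    have "sqrt m * norm e = sqrt (m * (norm e)\<^sup>2)" by (simp add: real_sqrt_mult)
    also have "\<dots> \<le> sqrt (G c q e e)" using m(2) q by simp
    finally have "norm e \<le> 1 / sqrt m * sqrt (G c q e e)" using sm by (simp add: field_simps)
    also have "\<dots> \<le> \<Lambda> * sqrt (G c q e e)"
    proof (rule mult_right_mono[OF \<Lambda>(4)])
      have "0 \<le> m * (norm e)\<^sup>2" using m(1) by simp
      then show "0 \<le> sqrt (G c q e e)" using m(2) q by (meson order_trans real_sqrt_ge_zero)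
    qed
    finally show "norm e \<le> \<Lambda> * sqrt (G c q e e)" .
    have "\<bar>G c q e e'\<bar> \<le> M1 * norm e * norm e'" using M1(2) q by blast
    also have "\<dots> \<le> \<Lambda>\<^sup>2 * norm e * norm e'" using \<Lambda>2 by (intro mult_right_mono) auto
    finally show "\<bar>G c q e e'\<bar> \<le> \<Lambda>\<^sup>2 * norm e * norm e'" .
  next
    fix p and u :: 'e assume "p \<in> fst c" "snd c p \<in> ?Q"
    then have "norm (christoffel A g c p u u) \<le> M2 * (norm u)\<^sup>2" using M2(2) by blast
    also have "\<dots> \<le> \<Lambda> * (norm u)\<^sup>2" using \<Lambda> by (intro mult_right_mono) auto
    finally show "norm (christoffel A g c p u u) \<le> \<Lambda> * (norm u)\<^sup>2" .
  qed
  then show ?thesis by blast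
qed

text \<open>The chain rule with each transition map. The parameter set stays general because both
  segments on [0,1] and the final curve on [0,\<epsilon>) are lifted this way.\<close>

lemma (in riemannian) has_velocity_chart_curve:
  assumes c: "c \<in> A" "\<beta> t \<in> dom c" and \<beta>: "(\<beta> has_vector_derivative w) (at t within T)"
  shows "has_velocity A (\<lambda>s. chart_inv c (\<beta> s)) (coord_vec A c (chart_inv c (\<beta> t)) w) t T"
  unfolding has_velocity_def
proof (intro conjI ballI impI)
  let ?p = "chart_inv c (\<beta> t)"
  have p: "?p \<in> fst c" "snd c ?p = \<beta> t" using c by auto
  show "coord_vec A c ?p w \<in> TS ?p" by (rule coord_vec_in[OF c(1) p(1)])
  have "continuous (at t within T) \<beta>" using \<beta> by (rule has_vector_derivative_continuous)
  then show "continuous (at t within T) (\<lambda>s. chart_inv c (\<beta> s))"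
    using isCont_inv[OF c] by (metis continuous_within_compose3)
  fix c' assume c': "c' \<in> A" "?p \<in> fst c'"
  have "(snd c' \<circ> chart_inv c has_derivative trans_deriv c c' ?p) (at (\<beta> t) within \<beta> ` T)"
    using has_derivative_trans[OF c(1) c'(1) p(1) c'(2)] p(2) has_derivative_at_withinI by metis
  with \<beta>[unfolded has_vector_derivative_def]
  have "((snd c' \<circ> chart_inv c) \<circ> \<beta> has_derivative trans_deriv c c' ?p \<circ> (\<lambda>h. h *\<^sub>R w)) (at t within T)"
    by (rule diff_chain_within)
  then show "((\<lambda>s. snd c' (chart_inv c (\<beta> s))) has_vector_derivative coord_vec A c ?p w c') (at t within T)"
    using bounded_linear.linear[OF bounded_linear_trans[OF c(1) c'(1) p(1) c'(2)]] c'
    unfolding has_vector_derivative_def comp_def by (simp add: linear_scale coord_vec_def)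
qed

context riemannian_chart
begin

abbreviation \<phi> :: "'m \<Rightarrow> 'e" where "\<phi> \<equiv> snd c"
abbreviation \<psi> :: "'e \<Rightarrow> 'm" where "\<psi> \<equiv> chart_inv c"
abbreviation Q :: "'e set" where "Q \<equiv> cball q0 R"

lemma Q_dom: "q \<in> Q \<Longrightarrow> q \<in> dom c"
  using cball_dom by blast

lemma \<psi>_in [simp]: "q \<in> Q \<Longrightarrow> \<psi> q \<in> fst c"
  and \<phi>_\<psi> [simp]: "q \<in> Q \<Longrightarrow> \<phi> (\<psi> q) = q"
  using Q_dom c by auto

lemma segment_velocity:
  assumes q: "q \<in> Q" "q' \<in> Q" and t: "t \<in> {0..1}"
  defines "\<gamma> \<equiv> \<lambda>t. \<psi> (q + t *\<^sub>R (q' - q))"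
  shows "velocity A \<gamma> {0..1} t = coord_vec A c (\<gamma> t) (q' - q)"
    and "has_velocity A \<gamma> (velocity A \<gamma> {0..1} t) t {0..1}"
proof -
  have pt: "q + t *\<^sub>R (q' - q) \<in> Q"
    using convexD_alt[OF convex_cball q, of t] t by (simp add: algebra_simps)
  have "((\<lambda>s. q + s *\<^sub>R (q' - q)) has_vector_derivative (q' - q)) (at t within {0..1})"
    unfolding has_vector_derivative_def by (auto intro!: derivative_eq_intros)
  from has_velocity_chart_curve[OF c Q_dom[OF pt] this]
  have v: "has_velocity A \<gamma> (coord_vec A c (\<gamma> t) (q' - q)) t {0..1}" by (simp add: \<gamma>_def)
  show eq: "velocity A \<gamma> {0..1} t = coord_vec A c (\<gamma> t) (q' - q)"
  proof
    fix c'
    show "velocity A \<gamma> {0..1} t c' = coord_vec A c (\<gamma> t) (q' - q) c'"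
    proof (cases "c' \<in> A \<and> \<gamma> t \<in> fst c'")
      case True
      then show ?thesis using velocity_eq[OF _ _ t] v unfolding has_velocity_def by blast
    qed (auto simp: coord_vec_def velocity_def)
  qed
  show "has_velocity A \<gamma> (velocity A \<gamma> {0..1} t) t {0..1}" unfolding eq by (rule v)
qed

text \<open>The straight coordinate segment is an admissible competitor in the infimum. Most of the
  proof checks that its velocity is continuous in every chart, not only in \<open>c\<close>.\<close>

lemma rdist_le:
  assumes q: "q \<in> Q" "q' \<in> Q"
  shows "rdist A g (\<psi> q) (\<psi> q') \<le> ereal (\<Lambda> * norm (q' - q))"
proof -
  define l where "l t = q + t *\<^sub>R (q' - q)" for t :: real
  define \<gamma> where "\<gamma> t = \<psi> (l t)" for t
  have vel: "velocity A \<gamma> {0..1} t = coord_vec A c (\<gamma> t) (q' - q)"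
    "has_velocity A \<gamma> (velocity A \<gamma> {0..1} t) t {0..1}" if "t \<in> {0..1}" for t
    using segment_velocity[OF q that] unfolding \<gamma>_def[abs_def] l_def by auto
  have l: "l t \<in> Q" if "t \<in> {0..1}" for t
    using convexD_alt[OF convex_cball q, of t] that by (simp add: l_def algebra_simps)
  have "continuous_on {t \<in> {0..1}. \<gamma> t \<in> fst c'} (\<lambda>t. velocity A \<gamma> {0..1} t c')" if c': "c' \<in> A" for c'
  proof -
    have "continuous_on (\<phi> ` (fst c \<inter> fst c')) (\<lambda>x. frechet_derivative (snd c' \<circ> \<psi>) (at x) (q' - q))"
      using trans_smooth[OF c c', unfolded smooth_on_def, THEN spec, of "Suc 0"] by simp
    moreover have "continuous_on {t \<in> {0..1}. \<gamma> t \<in> fst c'} l"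
      unfolding l_def by (intro continuous_intros)
    moreover have "l ` {t \<in> {0..1}. \<gamma> t \<in> fst c'} \<subseteq> \<phi> ` (fst c \<inter> fst c')"
    proof clarify
      fix t assume "t \<in> {0..1::real}" "\<gamma> t \<in> fst c'"
      then show "l t \<in> \<phi> ` (fst c \<inter> fst c')"
        using l[of t] by (intro image_eqI[of _ _ "\<gamma> t"]) (auto simp: \<gamma>_def)
    qed
    ultimately have "continuous_on {t \<in> {0..1}. \<gamma> t \<in> fst c'}
        (\<lambda>t. frechet_derivative (snd c' \<circ> \<psi>) (at (l t)) (q' - q))"
      by (rule continuous_on_compose2)
    then show ?thesis
    proof (rule continuous_on_eq)
      fix t assume "t \<in> {t \<in> {0..1}. \<gamma> t \<in> fst c'}"
      then have t: "t \<in> {0..1}" "\<gamma> t \<in> fst c'" by auto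
      then show "frechet_derivative (snd c' \<circ> \<psi>) (at (l t)) (q' - q) = velocity A \<gamma> {0..1} t c'"
        using c' l[OF t(1)] by (simp add: vel(1)[OF t(1)] coord_vec_def trans_deriv_def \<gamma>_def)
    qed
  qed
  then have "C1_curve_on A \<gamma> {0..1}"
    unfolding C1_curve_on_def using vel(2) by blast
  then have "piecewise_C1_curve A \<gamma>"
    unfolding piecewise_C1_curve_def by (intro exI[of _ "{0, 1}"]) auto
  moreover have "\<gamma> 0 = \<psi> q" "\<gamma> 1 = \<psi> q'" by (auto simp: \<gamma>_def l_def)
  ultimately have "rdist A g (\<psi> q) (\<psi> q') \<le> ereal (curve_length A g \<gamma>)"
    unfolding rdist_def by (intro INF_lower) auto
  also have "curve_length A g \<gamma> \<le> \<Lambda> * norm (q' - q)"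
  proof -
    let ?f = "\<lambda>t. tnorm g (\<gamma> t) (velocity A \<gamma> {0..1} t)"
    have le: "?f t \<le> \<Lambda> * norm (q' - q)" if t: "t \<in> {0..1}" for t
    proof -
      have "?f t = sqrt (G c (l t) (q' - q) (q' - q))"
        unfolding tnorm_def vel(1)[OF t] metric_coeff_def Let_def \<gamma>_def ..
      also have "\<dots> \<le> sqrt (\<Lambda>\<^sup>2 * norm (q' - q) * norm (q' - q))"
        using G_bound[OF l[OF t], of "q' - q" "q' - q"] by simp
      also have "\<dots> = \<Lambda> * norm (q' - q)"
        using \<Lambda>_pos by (simp add: real_sqrt_mult mult.assoc)
      finally show ?thesis .
    qed
    show ?thesis
    \<comment> \<open>A non-integrable function has integral 0 by convention, so the upper bound
      holds in both cases.\<close>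
    proof (cases "?f integrable_on {0..1}")
      case True
      then have "integral {0..1} ?f \<le> integral {0..1} (\<lambda>t::real. \<Lambda> * norm (q' - q))"
        by (rule integral_le) (use le in auto)
      then show ?thesis unfolding curve_length_def by simp
    next
      case False
      then show ?thesis
        using \<Lambda>_pos by (simp add: curve_length_def not_integrable_integral)
    qed
  qed
  finally show ?thesis by simp
qed

end

section \<open>Short geodesics and the inverse exponential map in coordinates\<close>

context riemannian_chart
begin

lemma geodesic_continuous: "geodesic A g \<gamma> \<Longrightarrow> continuous_on {0..1} \<gamma>"
  unfolding continuous_on_eq_continuous_within using geodesicD(2) by blast

lemma norm_velocity_le:
  assumes "geodesic A g \<gamma>" "t \<in> {0..1}" "\<gamma> t \<in> fst c" "\<phi> (\<gamma> t) \<in> Q"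
  shows "norm (velocity A \<gamma> {0..1} t c) \<le> \<Lambda> * tnorm g (\<gamma> 0) (velocity A \<gamma> {0..1} 0)"
  using norm_le[OF assms(4), of "velocity A \<gamma> {0..1} t c"] geodesicD(1)[OF assms(1,2)]
  unfolding geodesic_constant_speed[OF assms(1,2), symmetric] by (simp add: tnorm_def g_eq_G[OF c assms(3)])

lemma geodesic_displacement_le:
  assumes \<gamma>: "geodesic A g \<gamma>" and b: "b \<in> {0..1}"
    and Q: "\<And>t. t \<in> {0..b} \<Longrightarrow> \<gamma> t \<in> fst c \<and> \<phi> (\<gamma> t) \<in> Q"
  shows "norm (\<phi> (\<gamma> b) - \<phi> (\<gamma> 0)) \<le> \<Lambda> * tnorm g (\<gamma> 0) (velocity A \<gamma> {0..1} 0)"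
proof -
  let ?L = "tnorm g (\<gamma> 0) (velocity A \<gamma> {0..1} 0)"
  have *: "((\<lambda>s. \<phi> (\<gamma> s)) has_derivative (\<lambda>h. h *\<^sub>R velocity A \<gamma> {0..1} t c)) (at t within {0..b})"
    if "t \<in> {0..b}" for t
    using geodesicD(3)[OF \<gamma> _ c, of t] Q[OF that] b that unfolding has_vector_derivative_def
    by (auto intro: has_derivative_subset)
  have onorm: "onorm (\<lambda>h::real. h *\<^sub>R velocity A \<gamma> {0..1} t c) \<le> \<Lambda> * ?L" if "t \<in> {0..b}" for t
    using norm_velocity_le[OF \<gamma>, of t] Q[OF that] b that
    by (intro onorm_le) (auto simp: mult_right_mono mult.commute[of "\<bar>_\<bar>"])
  have "norm (\<phi> (\<gamma> b) - \<phi> (\<gamma> 0)) \<le> \<Lambda> * ?L * norm (b - 0)"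
    by (rule differentiable_bound[OF convex_real_interval(5) * onorm]) (use b in auto)
  also have "\<dots> \<le> \<Lambda> * ?L * 1"
  proof (rule mult_left_mono)
    have "0 \<le> norm (velocity A \<gamma> {0..1} 0 c)" by simp
    also have "\<dots> \<le> \<Lambda> * ?L" using norm_velocity_le[OF \<gamma>, of 0] Q[of 0] b by auto
    finally show "0 \<le> \<Lambda> * ?L" .
  qed (use b in auto)
  finally show ?thesis by simp
qed

text \<open>First exit time from the open coordinate ball \<open>V\<close>: up to and including that
  time the curve lies in the closed ball, so the displacement bound applies and places the exit
  point back inside \<open>V\<close>.\<close>

lemma short_geodesic_in_chart:
  assumes \<gamma>: "geodesic A g \<gamma>" "\<gamma> 0 = \<psi> q" and q: "norm (q - q0) \<le> R / 2"
    and short: "\<Lambda> * tnorm g (\<gamma> 0) (velocity A \<gamma> {0..1} 0) < R / 2" and t: "t \<in> {0..1}"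
  shows "\<gamma> t \<in> fst c \<and> \<phi> (\<gamma> t) \<in> Q"
proof -
  define V where "V = fst c \<inter> \<phi> -` ball q0 R"
  have "open V"
    unfolding V_def by (rule continuous_open_preimage[OF continuous_chart[OF c] open_fst[OF c] open_ball])
  \<comment> \<open>The exit point must still have coordinates. It does because the image of the
    closed ball is compact, hence closed in the Hausdorff space \<open>'m\<close>.\<close>
  have Vsub: "closure V \<subseteq> \<psi> ` Q"
  proof (rule closure_minimal)
    show "V \<subseteq> \<psi> ` Q"
    proof
      fix p assume "p \<in> V"
      then show "p \<in> \<psi> ` Q" using c by (intro image_eqI[of _ _ "\<phi> p"]) (auto simp: V_def)
    qed
    have "continuous_on Q \<psi>" by (rule continuous_on_subset[OF continuous_inv[OF c] cball_dom])
    then show "closed (\<psi> ` Q)" by (intro compact_imp_closed compact_continuous_image compact_cball)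
  qed
  have inV: "\<gamma> s \<in> V" if "s \<in> {0..1}" for s
  proof (rule ccontr)
    assume "\<gamma> s \<notin> V"
    define B where "B = {0..1} \<inter> \<gamma> -` (- V)"
    have "closed B"
      unfolding B_def using geodesic_continuous[OF \<gamma>(1)] \<open>open V\<close>
      by (intro continuous_closed_preimage) auto
    then have "compact B" using compact_Int_closed[of "{0..1::real}" B] by (simp add: B_def Int_assoc[symmetric])
    moreover have "B \<noteq> {}" using \<open>\<gamma> s \<notin> V\<close> that by (auto simp: B_def)
    ultimately obtain b where b: "b \<in> B" "\<And>t. t \<in> B \<Longrightarrow> b \<le> t"
      using compact_attains_inf by metis
    have b01: "b \<in> {0..1}" "\<gamma> b \<notin> V" using b(1) by (auto simp: B_def)
    have qQ: "q \<in> Q" "q \<in> ball q0 R"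
      using q R_pos by (auto simp: dist_norm norm_minus_commute)
    have "\<gamma> 0 \<in> V" using qQ \<gamma>(2) by (auto simp: V_def)
    then have "b > 0" using b01 by (cases "b = 0") auto
    have before: "\<gamma> t \<in> V" if "t \<in> {0..<b}" for t
      using b(2)[of t] that b01 by (force simp: B_def)
    have "\<gamma> b \<in> closure V"
    proof -
      have "continuous_on (closure {0..<b}) \<gamma>"
        using continuous_on_subset[OF geodesic_continuous[OF \<gamma>(1)]] b01 \<open>b > 0\<close> by simp
      then have "\<gamma> ` closure {0..<b} \<subseteq> closure V"
        by (rule image_closure_subset) (use before closure_subset[of V] in auto)
      then show ?thesis using \<open>b > 0\<close> by auto
    qed
    then have "\<gamma> b \<in> \<psi> ` Q" using Vsub by blast
    have "\<gamma> t \<in> fst c \<and> \<phi> (\<gamma> t) \<in> Q" if "t \<in> {0..b}" for t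
    proof (cases "t = b")
      case True then show ?thesis using \<open>\<gamma> b \<in> \<psi> ` Q\<close> by auto
    next
      case False then show ?thesis using before[of t] that by (auto simp: V_def)
    qed
    then have "norm (\<phi> (\<gamma> b) - \<phi> (\<gamma> 0)) < R / 2"
      using geodesic_displacement_le[OF \<gamma>(1) b01(1)] short by fastforce
    moreover have "\<phi> (\<gamma> 0) = q" using \<gamma>(2) qQ by simp
    ultimately have "norm (\<phi> (\<gamma> b) - q0) < R"
      using q norm_triangle_ineq[of "\<phi> (\<gamma> b) - q" "q - q0"] by simp
    then have "\<gamma> b \<in> V" using \<open>\<gamma> b \<in> \<psi> ` Q\<close> by (auto simp: V_def dist_norm norm_minus_commute)
    then show False using b01 by simp
  qed
  then show ?thesis using t by (force simp: V_def)
qed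

text \<open>The coordinate velocity is at most \<Lambda> L, so by the geodesic equation the
  acceleration is at most \<Lambda> (\<Lambda> L)^2. Two applications of the mean value inequality,
  to the velocity and then to t \<mapsto> u(t) - t u'(0), give the bound.\<close>

lemma short_geodesic_velocity:
  assumes \<gamma>: "geodesic A g \<gamma>" "\<gamma> 0 = \<psi> q" and q: "norm (q - q0) \<le> R / 2"
  defines "L \<equiv> tnorm g (\<gamma> 0) (velocity A \<gamma> {0..1} 0)"
  assumes short: "\<Lambda> * L < R / 2"
  shows "norm (velocity A \<gamma> {0..1} 0 c - (\<phi> (\<gamma> 1) - q)) \<le> \<Lambda> ^ 3 * L\<^sup>2"
proof -
  let ?w = "\<lambda>t. velocity A \<gamma> {0..1} t c" and ?u = "\<lambda>t. \<phi> (\<gamma> t)"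
  let ?K = "\<Lambda> ^ 3 * L\<^sup>2"
  have K: "0 \<le> ?K" using \<Lambda>_pos by simp
  have Q: "\<gamma> t \<in> fst c" "?u t \<in> Q" if "t \<in> {0..1}" for t
    using short_geodesic_in_chart[OF \<gamma> q short[unfolded L_def] that] by auto
  have acc: "norm (- christoffel A g c (\<gamma> t) (?w t) (?w t)) \<le> ?K" if t: "t \<in> {0..1}" for t
  proof -
    have "norm (christoffel A g c (\<gamma> t) (?w t) (?w t)) \<le> \<Lambda> * (norm (?w t))\<^sup>2"
      by (rule christoffel_bound[OF Q[OF t]])
    also have "\<dots> \<le> \<Lambda> * (\<Lambda> * L)\<^sup>2"
      unfolding L_def using \<Lambda>_pos norm_velocity_le[OF \<gamma>(1) t Q[OF t]]
      by (intro mult_left_mono power_mono) auto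
    finally show ?thesis by (simp add: power_mult_distrib power3_eq_cube power2_eq_square mult_ac)
  qed
  have scale: "onorm (\<lambda>h::real. h *\<^sub>R a) \<le> ?K" if "norm a \<le> ?K" for a :: 'e
    using that K by (intro onorm_le) (auto simp: mult_right_mono mult.commute[of "\<bar>_\<bar>"])
  have w: "norm (?w t - ?w 0) \<le> ?K" if t: "t \<in> {0..1}" for t
  proof -
    have "norm (?w t - ?w 0) \<le> ?K * norm (t - 0)"
      by (rule differentiable_bound[OF convex_real_interval(5)
           geodesicD(4)[OF \<gamma>(1) _ c Q(1), unfolded has_vector_derivative_def] scale[OF acc]]) (use t in auto)
    also have "\<dots> \<le> ?K * 1" using t K by (intro mult_left_mono) auto
    finally show ?thesis by simp
  qed
  have "norm ((?u 1 - 1 *\<^sub>R ?w 0) - (?u 0 - 0 *\<^sub>R ?w 0)) \<le> ?K * norm (1 - 0 :: real)"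
  proof (rule differentiable_bound[OF convex_real_interval(5)])
    fix t :: real assume t: "t \<in> {0..1}"
    have "((\<lambda>t. ?u t - t *\<^sub>R ?w 0) has_vector_derivative (?w t - 1 *\<^sub>R ?w 0)) (at t within {0..1})"
      by (intro has_vector_derivative_diff geodesicD(3)[OF \<gamma>(1) t c Q(1)[OF t]]
          bounded_linear.has_vector_derivative[OF bounded_linear_scaleR_left has_vector_derivative_id])
    then show "((\<lambda>t. ?u t - t *\<^sub>R ?w 0) has_derivative (\<lambda>h. h *\<^sub>R (?w t - ?w 0))) (at t within {0..1})"
      by (simp add: has_vector_derivative_def)
    show "onorm (\<lambda>h. h *\<^sub>R (?w t - ?w 0)) \<le> ?K" by (rule scale[OF w[OF t]])
  qed auto
  moreover have "?u 0 = q"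
    using \<gamma>(2) q R_pos by (auto simp: dist_norm norm_minus_commute)
  ultimately show ?thesis
    by (simp add: norm_minus_commute algebra_simps)
qed

end

context riemannian
begin

lemma exp_inv_geodesic:
  assumes "strongly_convex A g U" "x \<in> U" "y \<in> U"
  obtains \<gamma> where "minimizing_geodesic A g x y \<gamma>" "exp_inv A g x y = velocity A \<gamma> {0..1} 0"
proof -
  have "\<exists>\<gamma>. minimizing_geodesic A g x y \<gamma>"
    using assms unfolding strongly_convex_def by blast
  from that[OF someI_ex[OF this]] show thesis by (simp add: exp_inv_def)
qed

lemma
  assumes "strongly_convex A g U" "x \<in> U" "y \<in> U"
  shows exp_inv_in: "exp_inv A g x y \<in> TS x"
    and rdist_eq_tnorm: "rdist A g x y = ereal (tnorm g x (exp_inv A g x y))"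
proof -
  obtain \<gamma> where \<gamma>: "minimizing_geodesic A g x y \<gamma>" "exp_inv A g x y = velocity A \<gamma> {0..1} 0"
    by (rule exp_inv_geodesic[OF assms])
  then have "geodesic A g \<gamma>" "\<gamma> 0 = x" by (auto simp: minimizing_geodesic_def)
  then show "exp_inv A g x y \<in> TS x" using geodesicD(1)[of \<gamma> 0] \<gamma>(2) by auto
  show "rdist A g x y = ereal (tnorm g x (exp_inv A g x y))"
    using minimizing_geodesic_rdist[OF \<gamma>(1)] \<gamma>(2) by simp
qed

end

context riemannian_chart
begin

text \<open>Smallness is measured by the Riemannian distance L, so that \<open>y\<close> is not
  presupposed to lie in the chart. The companion \<open>exp_inv_chart\<close> starts from coordinate
  distance instead.\<close>

lemma exp_inv_near:
  assumes U: "strongly_convex A g U" "\<psi> q \<in> U" "y \<in> U" and q: "norm (q - q0) \<le> R / 2"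
  defines "L \<equiv> tnorm g (\<psi> q) (exp_inv A g (\<psi> q) y)"
  assumes short: "\<Lambda> * L < R / 2"
  shows "y \<in> fst c" "\<phi> y \<in> Q" "norm (\<phi> y - q) \<le> \<Lambda> * L"
    "norm (exp_inv A g (\<psi> q) y c - (\<phi> y - q)) \<le> \<Lambda> ^ 3 * L\<^sup>2"
proof -
  obtain \<gamma> where \<gamma>: "minimizing_geodesic A g (\<psi> q) y \<gamma>" "exp_inv A g (\<psi> q) y = velocity A \<gamma> {0..1} 0"
    by (rule exp_inv_geodesic[OF U])
  then have \<gamma>': "geodesic A g \<gamma>" "\<gamma> 0 = \<psi> q" "\<gamma> 1 = y" by (auto simp: minimizing_geodesic_def)
  have L: "L = tnorm g (\<gamma> 0) (velocity A \<gamma> {0..1} 0)" by (simp add: L_def \<gamma>(2) \<gamma>')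
  have inQ: "\<gamma> t \<in> fst c \<and> \<phi> (\<gamma> t) \<in> Q" if "t \<in> {0..1}" for t
    by (rule short_geodesic_in_chart[OF \<gamma>'(1,2) q short[unfolded L] that])
  then show "y \<in> fst c" "\<phi> y \<in> Q" using \<gamma>'(3) by force+
  have "q \<in> Q" using q R_pos by (simp add: dist_norm norm_minus_commute)
  then have "\<phi> (\<gamma> 0) = q" using \<gamma>' by simp
  then show "norm (\<phi> y - q) \<le> \<Lambda> * L"
    using geodesic_displacement_le[OF \<gamma>'(1), of 1] inQ by (simp add: L \<gamma>'(3))
  show "norm (exp_inv A g (\<psi> q) y c - (\<phi> y - q)) \<le> \<Lambda> ^ 3 * L\<^sup>2"
    using short_geodesic_velocity[OF \<gamma>'(1,2) q short[unfolded L]] unfolding \<gamma>(2) L \<gamma>'(3) .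
qed

text \<open>The segment bound gives L \<le> \<Lambda> |q' - q|. Inserted into the error \<Lambda>^3
  L^2, it produces \<Lambda>^5; the hypothesis with \<Lambda>^2 makes the geodesic short
  enough.\<close>

lemma exp_inv_chart:
  assumes U: "strongly_convex A g U" "\<psi> q \<in> U" "\<psi> q' \<in> U"
    and q: "norm (q - q0) \<le> R / 2" and q': "q' \<in> Q" and near: "\<Lambda>\<^sup>2 * norm (q' - q) < R / 2"
  shows "tnorm g (\<psi> q) (exp_inv A g (\<psi> q) (\<psi> q')) \<le> \<Lambda> * norm (q' - q)"
    "norm (exp_inv A g (\<psi> q) (\<psi> q') c - (q' - q)) \<le> \<Lambda> ^ 5 * (norm (q' - q))\<^sup>2"
proof -
  let ?L = "tnorm g (\<psi> q) (exp_inv A g (\<psi> q) (\<psi> q'))"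
  have "q \<in> Q" using q R_pos by (simp add: dist_norm norm_minus_commute)
  then show L: "?L \<le> \<Lambda> * norm (q' - q)"
    using rdist_le[OF _ q', of q] unfolding rdist_eq_tnorm[OF U] by simp
  then have "\<Lambda> * ?L \<le> \<Lambda> * (\<Lambda> * norm (q' - q))" using \<Lambda>_pos by (intro mult_left_mono) auto
  also have "\<dots> < R / 2" using near by (simp add: power2_eq_square mult.assoc)
  finally have "norm (exp_inv A g (\<psi> q) (\<psi> q') c - (\<phi> (\<psi> q') - q)) \<le> \<Lambda> ^ 3 * ?L\<^sup>2"
    by (rule exp_inv_near(4)[OF U q])
  also have "\<dots> \<le> \<Lambda> ^ 3 * (\<Lambda> * norm (q' - q))\<^sup>2"
  \<comment> \<open>Squaring needs L \<ge> 0, and \<open>sqrt\<close> is negative on negative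
    arguments; the sign is taken from \<open>norm_le\<close>.\<close>
  proof (intro mult_left_mono power_mono L)
    have "norm (exp_inv A g (\<psi> q) (\<psi> q') c) \<le> \<Lambda> * ?L"
      using norm_le[OF \<open>q \<in> Q\<close>, of "exp_inv A g (\<psi> q) (\<psi> q') c"] exp_inv_in[OF U] \<open>q \<in> Q\<close>
      by (simp add: tnorm_def g_eq_G[OF c])
    then have "0 \<le> \<Lambda> * ?L" by (rule order_trans[OF norm_ge_zero])
    then show "0 \<le> ?L" using \<Lambda>_pos by (simp add: zero_le_mult_iff)
  qed (use \<Lambda>_pos in auto)
  finally show "norm (exp_inv A g (\<psi> q) (\<psi> q') c - (q' - q)) \<le> \<Lambda> ^ 5 * (norm (q' - q))\<^sup>2"
    using q' by (simp add: power_mult_distrib mult.assoc[symmetric] power_add[symmetric])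
qed

lemma open_chart_ball: "open (fst c \<inter> \<phi> -` ball q0 r)"
  by (rule continuous_open_preimage[OF continuous_chart[OF c] open_fst[OF c] open_ball])

text \<open>Relates \<open>rball\<close> to the topology of the manifold: a coordinate ball is open
  and, by \<open>rdist_le\<close>, contained in the distance ball. So a strongly convex
  \<open>rball\<close> is a convex neighborhood of every point of that coordinate ball.\<close>

lemma \<psi>_interior_rball:
  assumes r: "r \<le> R" "\<Lambda> * r \<le> \<epsilon>" and q: "norm (q - q0) < r"
  shows "\<psi> q \<in> interior (rball A g (\<psi> q0) \<epsilon>)"
proof (rule interiorI[OF open_chart_ball[of r]])
  show "\<psi> q \<in> fst c \<inter> \<phi> -` ball q0 r" using q r by (auto simp: dist_norm norm_minus_commute)
  show "fst c \<inter> \<phi> -` ball q0 r \<subseteq> rball A g (\<psi> q0) \<epsilon>"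
  proof clarify
    fix p assume p: "p \<in> fst c" "\<phi> p \<in> ball q0 r"
    then have "rdist A g (\<psi> q0) (\<psi> (\<phi> p)) \<le> ereal (\<Lambda> * norm (\<phi> p - q0))"
      using r R_pos by (intro rdist_le) auto
    also have "\<Lambda> * norm (\<phi> p - q0) < \<Lambda> * r"
      using p(2) \<Lambda>_pos by (simp add: dist_norm norm_minus_commute)
    finally show "p \<in> rball A g (\<psi> q0) \<epsilon>"
      using p r c by (auto simp: rball_def intro: order_less_le_trans)
  qed
qed

lemma inner_exp_inv_le:
  assumes U: "strongly_convex A g U" "\<psi> q \<in> U" "y \<in> U" and q: "norm (q - q0) \<le> R / 2"
  defines "L \<equiv> tnorm g (\<psi> q) (exp_inv A g (\<psi> q) y)"
  shows "n \<bullet> exp_inv A g (\<psi> q) y c \<le> norm n * \<Lambda> * L"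
proof -
  have "q \<in> Q" using q R_pos by (simp add: dist_norm norm_minus_commute)
  have "n \<bullet> exp_inv A g (\<psi> q) y c \<le> norm n * norm (exp_inv A g (\<psi> q) y c)"
    by (rule norm_cauchy_schwarz)
  also have "\<dots> \<le> norm n * (\<Lambda> * L)"
    using norm_le[OF \<open>q \<in> Q\<close>, of "exp_inv A g (\<psi> q) y c"] exp_inv_in[OF U] \<open>q \<in> Q\<close>
    by (intro mult_left_mono) (auto simp: L_def tnorm_def g_eq_G[OF c])
  finally show ?thesis by (simp add: mult.assoc)
qed

text \<open>\<open>\<xi>\<close> is the metric dual of \<open>n\<close>, so g(\<xi>, exp^-1 y) is n
  paired with the coordinates of exp^-1 y. If y is close, these differ from the coordinate
  difference by a quadratic error.\<close>

lemma euclidean_normal_is_proximal: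
  assumes U: "convex_nbhd A g (\<psi> q) U" and q: "norm (q - q0) \<le> R / 2"
    and \<xi>: "\<xi> \<in> TS (\<psi> q)" "\<And>w. G c q (\<xi> c) w = n \<bullet> w"
    and n: "\<And>k. k \<in> Q \<Longrightarrow> \<psi> k \<in> S \<Longrightarrow> n \<bullet> (k - q) \<le> a * (norm (k - q))\<^sup>2" and a: "a > 0"
  shows "\<xi> \<in> proximal_normal_cone A g S (\<psi> q)"
proof -
  have conv: "strongly_convex A g U" and qU: "\<psi> q \<in> U"
    using U interior_subset by (auto simp: convex_nbhd_def)
  have qQ: "q \<in> Q" using q R_pos by (simp add: dist_norm norm_minus_commute)
  \<comment> \<open>The summands pay for the Euclidean inequality, for the error of exp^-1, and for
    the points with \<Lambda> L \<ge> R/2.\<close>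
  define \<sigma> where "\<sigma> = a * \<Lambda>\<^sup>2 + norm n * \<Lambda> ^ 3 + norm n * \<Lambda> * (2 * \<Lambda> / R)"
  have "\<sigma> > 0" using a \<Lambda>_pos R_pos by (auto simp: \<sigma>_def intro!: add_pos_nonneg)
  moreover have "ereal (g (\<psi> q) \<xi> (exp_inv A g (\<psi> q) y)) \<le> ereal \<sigma> * (rdist A g (\<psi> q) y)\<^sup>2"
    if y: "y \<in> U \<inter> S" for y
  proof -
    have yU: "y \<in> U" using y by simp
    let ?e = "exp_inv A g (\<psi> q) y"
    define L where "L = tnorm g (\<psi> q) ?e"
    have ge: "g (\<psi> q) \<xi> ?e = n \<bullet> ?e c"
      using g_eq_G[OF c _ \<xi>(1) exp_inv_in[OF conv qU yU]] qQ \<xi>(2) by simp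
    have "n \<bullet> ?e c \<le> \<sigma> * L\<^sup>2"
    proof (cases "\<Lambda> * L < R / 2")
      case True
      note near = exp_inv_near[OF conv qU yU q True[unfolded L_def], folded L_def]
      have "n \<bullet> ?e c = n \<bullet> (\<phi> y - q) + n \<bullet> (?e c - (\<phi> y - q))" by (simp add: inner_diff_right)
      also have "\<dots> \<le> a * (norm (\<phi> y - q))\<^sup>2 + norm n * norm (?e c - (\<phi> y - q))"
        using n[OF near(2)] near(1) y c by (intro add_mono norm_cauchy_schwarz) auto
      also have "\<dots> \<le> a * (\<Lambda> * L)\<^sup>2 + norm n * (\<Lambda> ^ 3 * L\<^sup>2)"
        using near(3,4) a by (intro add_mono mult_left_mono power_mono) auto
      also have "\<dots> \<le> \<sigma> * L\<^sup>2"
        using \<Lambda>_pos R_pos by (simp add: \<sigma>_def power_mult_distrib algebra_simps)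
      finally show ?thesis .
    next
      case False
      \<comment> \<open>Such a \<open>y\<close> may have no coordinates; this factor makes the
        Cauchy-Schwarz bound, linear in L, quadratic.\<close>
      then have far: "1 \<le> 2 * \<Lambda> / R * L" using R_pos by (simp add: field_simps)
      have "0 < \<Lambda> * L" using False R_pos by linarith
      then have L: "0 < L" using \<Lambda>_pos by (simp add: zero_less_mult_iff)
      have "n \<bullet> ?e c \<le> norm n * \<Lambda> * L * 1"
        using inner_exp_inv_le[OF conv qU yU q] by (simp add: L_def)
      also have "\<dots> \<le> norm n * \<Lambda> * L * (2 * \<Lambda> / R * L)"
        using far L \<Lambda>_pos by (intro mult_left_mono) auto
      also have "\<dots> = norm n * \<Lambda> * (2 * \<Lambda> / R) * L\<^sup>2" by (simp add: power2_eq_square)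
      also have "\<dots> \<le> \<sigma> * L\<^sup>2"
        using \<Lambda>_pos a by (intro mult_right_mono) (auto simp: \<sigma>_def)
      finally show ?thesis .
    qed
    then show ?thesis unfolding rdist_eq_tnorm[OF conv qU yU] ge L_def[symmetric] by simp
  qed
  ultimately show ?thesis
    unfolding proximal_normal_cone_def using \<xi>(1) U by blast
qed

end

section \<open>Transfer of prox-regularity and of tangents to coordinates\<close>

context riemannian_chart
begin

text \<open>Cutting with the closed ball \<open>Q\<close>, on which \<open>\<psi>\<close> is
  continuous, makes the coordinate image closed in the whole Euclidean space, so nearest points
  exist.\<close>

definition chart_set :: "'m set \<Rightarrow> 'e set" where
  "chart_set S = Q \<inter> \<psi> -` S"

lemma closed_chart_set: "closed S \<Longrightarrow> closed (chart_set S)"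
  unfolding chart_set_def
  by (intro continuous_closed_preimage continuous_on_subset[OF continuous_inv[OF c] cball_dom]) auto

text \<open>A Euclidean normal, scaled to s n and dualized by the metric, is a proximal normal of
  \<open>S\<close> shorter than the radius of prox-regularity. The resulting inequality is divided
  by s, which is inversely proportional to |n|; this produces the factor
  \<open>norm n\<close>.\<close>

lemma prox_regular_imp_euclidean:
  assumes S: "closed S" "\<psi> q0 \<in> S" and prox: "prox_regular_at A g S (\<psi> q0)"
  shows "\<exists>r \<sigma>. euclidean_prox_regular (chart_set S) q0 r \<sigma>"
proof -
  obtain \<epsilon> \<sigma>0 where \<epsilon>: "\<epsilon> > 0" "\<sigma>0 > 0" and conv: "strongly_convex A g (rball A g (\<psi> q0) \<epsilon>)"
    and pr: "\<And>x v y. \<lbrakk>x \<in> S \<inter> rball A g (\<psi> q0) \<epsilon>; v \<in> proximal_normal_cone A g S x; tnorm g x v < \<epsilon>;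
      y \<in> S \<inter> rball A g (\<psi> q0) \<epsilon>\<rbrakk> \<Longrightarrow>
      ereal (g x v (exp_inv A g x y)) \<le> ereal \<sigma>0 * (rdist A g x y)\<^sup>2"
    using prox unfolding prox_regular_at_def by blast
  let ?U = "rball A g (\<psi> q0) \<epsilon>"
  \<comment> \<open>R/2 allows base points for geodesics, \<epsilon>/\<Lambda> puts the points into
    the convex ball, and R/(8\<Lambda>^2) meets the hypothesis of \<open>exp_inv_chart\<close> for
    two points less than 2r apart.\<close>
  define r where "r = min (R / 2) (min (\<epsilon> / \<Lambda>) (R / (8 * \<Lambda>\<^sup>2)))"
  have r_pos: "r > 0" using R_pos \<epsilon> \<Lambda>_pos by (simp add: r_def)
  have r: "r \<le> R" "\<Lambda> * r \<le> \<epsilon>" "r \<le> R / 2"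
  proof -
    show "r \<le> R / 2" unfolding r_def by (rule min.cobounded1)
    then show "r \<le> R" using R_pos by linarith
    have "r \<le> \<epsilon> / \<Lambda>" by (simp add: r_def)
    then show "\<Lambda> * r \<le> \<epsilon>" using \<Lambda>_pos by (simp add: field_simps)
  qed
  have r2: "\<Lambda>\<^sup>2 * (2 * r) < R / 2"
  proof -
    have "r \<le> R / (8 * \<Lambda>\<^sup>2)" by (simp add: r_def)
    then have "\<Lambda>\<^sup>2 * (2 * r) \<le> R / 4" using \<Lambda>_pos by (simp add: field_simps)
    then show ?thesis using R_pos by simp
  qed
  \<comment> \<open>The first summand times |n| is \<sigma>0 \<Lambda>^2 / s for the scale s chosen
    below; the second is the error of exp^-1.\<close>
  define \<sigma> where "\<sigma> = 2 * \<Lambda> ^ 3 * \<sigma>0 / \<epsilon> + \<Lambda> ^ 5"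
  have "euclidean_prox_regular (chart_set S) q0 r \<sigma>"
  proof
    show "closed (chart_set S)" by (rule closed_chart_set[OF S(1)])
    show "q0 \<in> chart_set S" using S(2) R_pos by (simp add: chart_set_def)
    show "r > 0" by (rule r_pos)
    show "\<sigma> > 0" using \<Lambda>_pos \<epsilon> by (simp add: \<sigma>_def add_pos_pos)
    fix q n y
    assume q: "q \<in> chart_set S" "dist q q0 < r" and y: "y \<in> chart_set S" "dist y q0 < r"
      and n: "\<forall>k\<in>chart_set S. n \<bullet> (k - q) \<le> (norm (k - q))\<^sup>2 / 2"
    have qQ: "q \<in> Q" "\<psi> q \<in> S" and yQ: "y \<in> Q" "\<psi> y \<in> S" using q y by (auto simp: chart_set_def)
    have qr: "norm (q - q0) \<le> R / 2" using q(2) r by (simp add: dist_norm)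
    have int: "\<psi> q \<in> interior ?U" and yU: "\<psi> y \<in> ?U"
      using \<psi>_interior_rball[OF r(1,2)] q(2) y(2) interior_subset[of ?U] by (auto simp: dist_norm)
    then have qU: "\<psi> q \<in> ?U" using interior_subset by blast
    let ?d = "y - q" and ?e = "exp_inv A g (\<psi> q) (\<psi> y)"
    have "norm ?d < 2 * r"
      using dist_triangle2[of y q q0] q(2) y(2) by (simp add: dist_norm)
    then have "\<Lambda>\<^sup>2 * norm ?d \<le> \<Lambda>\<^sup>2 * (2 * r)" by (intro mult_left_mono) auto
    then have "\<Lambda>\<^sup>2 * norm ?d < R / 2" using r2 by linarith
    note e = exp_inv_chart[OF conv qU yU qr yQ(1) this]
    show "n \<bullet> ?d \<le> \<sigma> * norm n * (norm ?d)\<^sup>2"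
    proof (cases "n = 0")
      case False
      \<comment> \<open>Chosen so that the dual vector has norm T with T^2 = s n.k \<le> s |n|
        \<Lambda> T = (\<epsilon>/2) T.\<close>
      define s where "s = \<epsilon> / (2 * \<Lambda> * norm n)"
      have s: "s > 0" "s * norm n * \<Lambda> = \<epsilon> / 2" using False \<epsilon> \<Lambda>_pos by (auto simp: s_def)
      have "linear (\<lambda>w. (s *\<^sub>R n) \<bullet> w)" by (intro bounded_linear.linear bounded_linear_inner_right)
      from ex_tangent_representer[OF c Q_dom[OF qQ(1)] this]
      obtain k where k: "\<And>w. G c q k w = (s *\<^sub>R n) \<bullet> w" by blast
      define \<xi> where "\<xi> = coord_vec A c (\<psi> q) k"
      have \<xi>: "\<xi> \<in> TS (\<psi> q)" "\<xi> c = k"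
        unfolding \<xi>_def using coord_vec_in[OF c] coord_vec_self[OF c] qQ by auto
      have "\<xi> \<in> proximal_normal_cone A g S (\<psi> q)"
      proof (rule euclidean_normal_is_proximal[OF _ qr \<xi>(1)])
        show "convex_nbhd A g (\<psi> q) ?U" using int conv by (simp add: convex_nbhd_def)
        show "G c q (\<xi> c) w = (s *\<^sub>R n) \<bullet> w" for w by (simp only: \<xi>(2) k)
        show "(s *\<^sub>R n) \<bullet> (k - q) \<le> s / 2 * (norm (k - q))\<^sup>2" if "k \<in> Q" "\<psi> k \<in> S" for k
          using mult_left_mono[OF bspec[OF n, of k], of s] s(1) that by (simp add: chart_set_def)
        show "s / 2 > 0" using s(1) by simp
      qed
      moreover have "tnorm g (\<psi> q) \<xi> < \<epsilon>"
      proof -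
        define T where "T = tnorm g (\<psi> q) \<xi>"
        have T: "T = sqrt (G c q k k)"
          using qQ(1) \<xi> by (simp add: T_def tnorm_def g_eq_G[OF c])
        have kT: "norm k \<le> \<Lambda> * T" using norm_le[OF qQ(1), of k] by (simp add: T)
        then have "0 \<le> \<Lambda> * T" by (rule order_trans[OF norm_ge_zero])
        then have "0 \<le> T" using \<Lambda>_pos by (simp add: zero_le_mult_iff)
        then have "0 \<le> G c q k k" by (simp add: T)
        then have "T * T = (s *\<^sub>R n) \<bullet> k" by (simp add: T k)
        also have "\<dots> \<le> norm (s *\<^sub>R n) * norm k" by (rule norm_cauchy_schwarz)
        also have "\<dots> \<le> norm (s *\<^sub>R n) * (\<Lambda> * T)" by (intro mult_left_mono kT) auto
        also have "\<dots> = (\<epsilon> / 2) * T" using s by (simp add: mult.assoc[symmetric])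
        finally have "T \<le> \<epsilon> / 2" using \<epsilon> \<open>0 \<le> T\<close> by (cases "T = 0") (auto simp: mult_le_cancel_right)
        then show ?thesis using \<epsilon> by (simp add: T_def)
      qed
      ultimately have "ereal (g (\<psi> q) \<xi> ?e) \<le> ereal \<sigma>0 * (rdist A g (\<psi> q) (\<psi> y))\<^sup>2"
        using pr qQ qU yQ yU by blast
      moreover have "g (\<psi> q) \<xi> ?e = s * (n \<bullet> ?e c)"
        using g_eq_G[OF c _ \<xi>(1) exp_inv_in[OF conv qU yU]] qQ \<xi>(2) k by simp
      ultimately have "s * (n \<bullet> ?e c) \<le> \<sigma>0 * (tnorm g (\<psi> q) ?e)\<^sup>2"
        unfolding rdist_eq_tnorm[OF conv qU yU] by simp
      also have "\<dots> \<le> \<sigma>0 * (\<Lambda> * norm ?d)\<^sup>2"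
      proof (intro mult_left_mono power_mono e)
        have "0 \<le> g (\<psi> q) ?e ?e"
          using metric_props(4)[OF exp_inv_in[OF conv qU yU] exp_inv_in[OF conv qU yU]]
            metric_props(3)[OF exp_inv_in[OF conv qU yU] exp_inv_in[OF conv qU yU], of 0]
          by (cases "?e = (\<lambda>c. 0)") auto
        then show "0 \<le> tnorm g (\<psi> q) ?e" by (simp add: tnorm_def)
      qed (use \<epsilon> in auto)
      finally have "n \<bullet> ?e c \<le> \<sigma>0 * (\<Lambda> * norm ?d)\<^sup>2 / s" using s(1) by (simp add: field_simps)
      also have "\<dots> = 2 * \<Lambda> ^ 3 * \<sigma>0 / \<epsilon> * norm n * (norm ?d)\<^sup>2"
        using False \<epsilon> \<Lambda>_pos by (simp add: s_def field_simps power2_eq_square power3_eq_cube)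
      finally have A: "n \<bullet> ?e c \<le> 2 * \<Lambda> ^ 3 * \<sigma>0 / \<epsilon> * norm n * (norm ?d)\<^sup>2" .
      have "n \<bullet> (?d - ?e c) \<le> norm n * norm (?d - ?e c)" by (rule norm_cauchy_schwarz)
      also have "\<dots> \<le> norm n * (\<Lambda> ^ 5 * (norm ?d)\<^sup>2)"
        using e(2) by (intro mult_left_mono) (auto simp: norm_minus_commute)
      finally have "n \<bullet> (?d - ?e c) \<le> norm n * (\<Lambda> ^ 5 * (norm ?d)\<^sup>2)" .
      moreover have "n \<bullet> ?d = n \<bullet> ?e c + n \<bullet> (?d - ?e c)" by (simp add: inner_diff_right)
      ultimately show ?thesis using A by (simp add: \<sigma>_def algebra_simps)
    qed simp
  qed
  then show ?thesis by blast
qed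

text \<open>The quotients differ by at most a constant times |d| |d| / \<tau>, where d is the
  coordinate difference. As d tends to 0, it is enough that |d| / \<tau> is bounded: in one
  direction this is immediate, in the other it follows from |d| \<le> 2 |e|, with e the coordinates
  of exp^-1.\<close>

lemma exp_inv_quotient_iff:
  assumes U: "strongly_convex A g U" "\<psi> q0 \<in> U" and z: "range z \<subseteq> U" "z \<longlonglongrightarrow> \<psi> q0"
    and \<tau>: "\<And>i::nat. \<tau> i > 0"
  shows "(\<lambda>i. exp_inv A g (\<psi> q0) (z i) c /\<^sub>R \<tau> i) \<longlonglongrightarrow> w \<longleftrightarrow> (\<lambda>i. (\<phi> (z i) - q0) /\<^sub>R \<tau> i) \<longlonglongrightarrow> w"
    (is "?E \<longlonglongrightarrow> w \<longleftrightarrow> ?D \<longlonglongrightarrow> w")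
proof -
  let ?e = "\<lambda>i. exp_inv A g (\<psi> q0) (z i) c" and ?d = "\<lambda>i. \<phi> (z i) - q0"
  let ?C = "\<Lambda> ^ 5"
  have q0: "q0 \<in> Q" using R_pos by simp
  have C: "?C > 0" using \<Lambda>_pos by simp
  have "(\<lambda>i. \<phi> (z i)) \<longlonglongrightarrow> \<phi> (\<psi> q0)"
    using isCont_tendsto_compose[OF isCont_chart[OF c \<psi>_in[OF q0]] z(2)] .
  then have d0: "?d \<longlonglongrightarrow> 0" using q0 by (simp add: LIM_zero)
  \<comment> \<open>The last bound makes the quadratic error at most |d|/2, which yields |d| \<le> 2
    |e|; the middle one is for \<open>exp_inv_chart\<close>.\<close>
  define r where "r = min R (min (R / (4 * \<Lambda>\<^sup>2)) (1 / (2 * ?C)))"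
  have r: "r > 0" "r \<le> R" using R_pos \<Lambda>_pos by (auto simp: r_def)
  have "\<forall>\<^sub>F i in sequentially. z i \<in> fst c \<inter> \<phi> -` ball q0 r"
    using q0 r by (intro topological_tendstoD[OF z(2) open_chart_ball]) auto
  then have ev: "\<forall>\<^sub>F i in sequentially. norm (?e i - ?d i) \<le> ?C * (norm (?d i))\<^sup>2 \<and> norm (?d i) \<le> 2 * norm (?e i)"
  proof eventually_elim
    case (elim i)
    have d: "norm (?d i) < r" and zi: "z i \<in> fst c" "\<phi> (z i) \<in> Q"
      using elim r by (auto simp: dist_norm norm_minus_commute)
    have "norm (?d i) < R / (4 * \<Lambda>\<^sup>2)" using d by (simp add: r_def)
    then have "\<Lambda>\<^sup>2 * norm (?d i) < R / 2" using \<Lambda>_pos R_pos by (simp add: field_simps)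
    moreover have "z i \<in> U" using z(1) by blast
    ultimately have e: "norm (?e i - ?d i) \<le> ?C * (norm (?d i))\<^sup>2"
      using exp_inv_chart(2)[OF U(1,2), of "\<phi> (z i)"] zi c R_pos by simp
    have "norm (?d i) < 1 / (2 * ?C)" using d by (simp add: r_def)
    then have "?C * norm (?d i) \<le> 1 / 2" using C by (simp add: field_simps)
    then have "?C * norm (?d i) * norm (?d i) \<le> 1 / 2 * norm (?d i)" by (intro mult_right_mono) auto
    then have "norm (?d i) \<le> 2 * norm (?e i)"
      using e norm_triangle_ineq2[of "?d i" "?e i"]
      by (simp add: power2_eq_square norm_minus_commute mult.assoc)
    with e show ?case by simp
  qed
  have bound: "norm (?E i - ?D i) \<le> ?C * norm (?d i) * norm (?d i) / \<tau> i"
    if "norm (?e i - ?d i) \<le> ?C * (norm (?d i))\<^sup>2" for i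
  proof -
    have "norm (?E i - ?D i) = norm (?e i - ?d i) / \<tau> i"
      using \<tau>[of i] by (simp add: scaleR_diff_right[symmetric] divide_inverse mult.commute)
    also have "\<dots> \<le> ?C * (norm (?d i))\<^sup>2 / \<tau> i" using that \<tau>[of i] by (intro divide_right_mono) auto
    finally show ?thesis by (simp add: power2_eq_square)
  qed
  have nrm: "norm (x /\<^sub>R \<tau> i) = norm x / \<tau> i" for x :: 'e and i
    using \<tau>[of i] by (simp add: divide_inverse mult.commute)
  have zero: "(\<lambda>i. ?C * norm (?d i) * (2 * norm (f i))) \<longlonglongrightarrow> 0" if "f \<longlonglongrightarrow> w" for f
  proof -
    have "(\<lambda>i. ?C * norm (?d i) * (2 * norm (f i))) \<longlonglongrightarrow> ?C * norm (0::'e) * (2 * norm w)"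
      by (intro tendsto_intros d0 that)
    then show ?thesis by simp
  qed
  show ?thesis
  proof
    assume E: "?E \<longlonglongrightarrow> w"
    have "\<forall>\<^sub>F i in sequentially. norm (?E i - ?D i) \<le> ?C * norm (?d i) * (2 * norm (?E i))"
      using ev
    proof eventually_elim
      case (elim i)
      have "norm (?E i - ?D i) \<le> ?C * norm (?d i) * norm (?d i) / \<tau> i" using bound elim by blast
      also have "\<dots> \<le> ?C * norm (?d i) * (2 * norm (?e i)) / \<tau> i"
        using elim C \<tau>[of i] by (intro divide_right_mono mult_left_mono) auto
      finally show ?case unfolding nrm by simp
    qed
    then have "(\<lambda>i. ?E i - ?D i) \<longlonglongrightarrow> 0" using zero[OF E] by (rule Lim_null_comparison)
    from tendsto_diff[OF E this] show "?D \<longlonglongrightarrow> w" by simp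
  next
    assume D: "?D \<longlonglongrightarrow> w"
    have "\<forall>\<^sub>F i in sequentially. norm (?E i - ?D i) \<le> ?C * norm (?d i) * (2 * norm (?D i))"
      using ev
    proof eventually_elim
      case (elim i)
      have "norm (?E i - ?D i) \<le> ?C * norm (?d i) * norm (?d i) / \<tau> i" using bound elim by blast
      also have "\<dots> \<le> ?C * norm (?d i) * (2 * norm (?d i)) / \<tau> i"
        using C \<tau>[of i] by (intro divide_right_mono mult_left_mono) auto
      finally show ?case unfolding nrm by simp
    qed
    then have "(\<lambda>i. ?E i - ?D i) \<longlonglongrightarrow> 0" using zero[OF D] by (rule Lim_null_comparison)
    from tendsto_add[OF D this] show "?E \<longlonglongrightarrow> w" by simp
  qed
qed

end

text \<open>\<open>bouligand_cone\<close> asks for convergence in every chart around the point; the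
  linear transition derivative carries it over from one.\<close>

lemma (in riemannian) vec_tendsto_all_charts:
  assumes c: "c \<in> A" "x \<in> fst c" and v: "v \<in> TS x" and f: "\<And>i. f i \<in> TS x"
    and lim: "(\<lambda>i. f i c /\<^sub>R \<tau> i) \<longlonglongrightarrow> v c" and c': "c' \<in> A" "x \<in> fst c'"
  shows "(\<lambda>i. f i c' /\<^sub>R \<tau> i) \<longlonglongrightarrow> v c'"
proof -
  have u: "u c' = trans_deriv c c' x (u c)" if "u \<in> TS x" for u
    using fun_cong[OF tangent_eq_coord_vec[OF c that], of c'] c' by (simp add: coord_vec_def)
  note bl = bounded_linear_trans[OF c(1) c'(1) c(2) c'(2)]
  have "(\<lambda>i. trans_deriv c c' x (f i c /\<^sub>R \<tau> i)) \<longlonglongrightarrow> trans_deriv c c' x (v c)"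
    by (rule bounded_linear.tendsto[OF bl lim])
  then show ?thesis
    unfolding u[OF f] u[OF v] by (simp add: linear_scale[OF bounded_linear.linear[OF bl]])
qed

section \<open>Tangents from curves and curves from tangents\<close>

context riemannian_chart
begin

lemma bouligand_imp_curve:
  assumes S: "closed S" "\<psi> q0 \<in> S" and prox: "prox_regular_at A g S (\<psi> q0)"
    and v: "v \<in> bouligand_cone A g S (\<psi> q0)"
  shows "\<exists>\<epsilon>>0. \<exists>\<alpha>. continuous_on {0..<\<epsilon>} \<alpha> \<and> \<alpha> ` {0..<\<epsilon>} \<subseteq> S \<and> \<alpha> 0 = \<psi> q0 \<and>
    has_velocity A \<alpha> v 0 {0..<\<epsilon>}"
proof -
  have q0: "q0 \<in> Q" using R_pos by simp
  obtain r \<sigma> where "euclidean_prox_regular (chart_set S) q0 r \<sigma>"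
    using prox_regular_imp_euclidean[OF S prox] by blast
  then interpret euclidean_prox_regular "chart_set S" q0 r \<sigma> .
  from v[unfolded bouligand_cone_def mem_Collect_eq]
  obtain U z \<tau> where vT: "v \<in> TS (\<psi> q0)" and U: "convex_nbhd A g (\<psi> q0) U"
    and z: "range z \<subseteq> U \<inter> S" "z \<longlonglongrightarrow> \<psi> q0" and \<tau>: "\<forall>i::nat. 0 < \<tau> i" "\<tau> \<longlonglongrightarrow> 0"
    and lim: "\<forall>c\<in>A. \<psi> q0 \<in> fst c \<longrightarrow> (\<lambda>i. exp_inv A g (\<psi> q0) (z i) c /\<^sub>R \<tau> i) \<longlonglongrightarrow> v c"
    by (elim conjE exE) (rule that)
  have zU: "range z \<subseteq> U" using z(1) by simp
  have conv: "strongly_convex A g U" "\<psi> q0 \<in> U"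
    using U interior_subset by (auto simp: convex_nbhd_def)
  have "(\<lambda>i. (\<phi> (z i) - q0) /\<^sub>R \<tau> i) \<longlonglongrightarrow> v c"
    using lim[rule_format, OF c \<psi>_in[OF q0]] exp_inv_quotient_iff[OF conv zU z(2) \<tau>(1)[rule_format]] by simp
  have "\<forall>\<^sub>F i in sequentially. z i \<in> fst c \<inter> \<phi> -` ball q0 R"
    using q0 R_pos by (intro topological_tendstoD[OF z(2) open_chart_ball]) auto
  \<comment> \<open>The first terms of the sequence may lie outside the chart, so the Euclidean
    result is applied to a tail.\<close>
  then obtain N where N: "\<forall>i\<ge>N. z i \<in> fst c \<inter> \<phi> -` ball q0 R"
    unfolding eventually_sequentially by blast
  have K: "\<phi> (z (i + N)) \<in> chart_set S" for i
  proof -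
    have *: "z (i + N) \<in> fst c" "\<phi> (z (i + N)) \<in> ball q0 R" using N by simp_all
    moreover have "z (i + N) \<in> S" using z(1) by (meson IntD2 rangeI subsetD)
    moreover have "\<phi> (z (i + N)) \<in> Q" using *(2) ball_subset_cball by blast
    ultimately show ?thesis unfolding chart_set_def using inv_snd[OF c *(1)] by simp
  qed
  obtain \<epsilon> \<beta> where \<beta>: "\<epsilon> > 0" "continuous_on {0..<\<epsilon>} \<beta>" "\<beta> ` {0..<\<epsilon>} \<subseteq> chart_set S" "\<beta> 0 = q0"
    "(\<beta> has_vector_derivative v c) (at 0 within {0..<\<epsilon>})"
  proof (rule proximal_curve[of "\<lambda>i. \<phi> (z (i + N))" "\<lambda>i. \<tau> (i + N)", OF K \<tau>(1)[rule_format]])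
    show "(\<lambda>i. \<tau> (i + N)) \<longlonglongrightarrow> 0" using \<tau>(2) by (rule LIMSEQ_ignore_initial_segment)
    show "(\<lambda>i. (\<phi> (z (i + N)) - q0) /\<^sub>R \<tau> (i + N)) \<longlonglongrightarrow> v c"
      by (rule LIMSEQ_ignore_initial_segment) fact
  qed
  show ?thesis
  proof (intro exI conjI)
    show "\<epsilon> > 0" by (rule \<beta>(1))
    show "continuous_on {0..<\<epsilon>} (\<lambda>t. \<psi> (\<beta> t))"
    proof (rule continuous_on_compose2[OF continuous_inv[OF c] \<beta>(2)])
      show "\<beta> ` {0..<\<epsilon>} \<subseteq> dom c"
        using \<beta>(3) cball_dom unfolding chart_set_def by (meson Int_lower1 order_trans)
    qed
    show "(\<lambda>t. \<psi> (\<beta> t)) ` {0..<\<epsilon>} \<subseteq> S" using \<beta>(3) unfolding chart_set_def by blast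
    show "\<psi> (\<beta> 0) = \<psi> q0" by (simp add: \<beta>(4))
    have "has_velocity A (\<lambda>t. \<psi> (\<beta> t)) (coord_vec A c (\<psi> (\<beta> 0)) (v c)) 0 {0..<\<epsilon>}"
      by (rule has_velocity_chart_curve[OF c _ \<beta>(5)]) (use Q_dom[OF q0] \<beta>(4) in simp)
    then show "has_velocity A (\<lambda>t. \<psi> (\<beta> t)) v 0 {0..<\<epsilon>}"
      using tangent_eq_coord_vec[OF c \<psi>_in[OF q0] vT] by (simp add: \<beta>(4))
  qed
qed

text \<open>Sampling the curve along times decreasing to 0 gives the sequence, and the right
  derivative in the chart gives its difference quotients. The ball of prox-regularity serves as the
  convex neighborhood.\<close>

lemma curve_imp_bouligand:
  assumes S: "\<psi> q0 \<in> S" and prox: "prox_regular_at A g S (\<psi> q0)"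
    and \<alpha>: "\<epsilon> > 0" "\<alpha> ` {0..<\<epsilon>} \<subseteq> S" "\<alpha> 0 = \<psi> q0" "has_velocity A \<alpha> v 0 {0..<\<epsilon>}"
  shows "v \<in> bouligand_cone A g S (\<psi> q0)"
proof -
  have q0: "q0 \<in> Q" using R_pos by simp
  note vel = \<alpha>(4)[unfolded has_velocity_def \<alpha>(3)]
  have vT: "v \<in> TS (\<psi> q0)" and cont: "continuous (at 0 within {0..<\<epsilon>}) \<alpha>"
    using vel by simp_all
  have der: "((\<lambda>s. \<phi> (\<alpha> s)) has_vector_derivative v c) (at 0 within {0..<\<epsilon>})"
    using conjunct2[OF conjunct2[OF vel]] c \<psi>_in[OF q0] by (simp only: simp_thms)
  obtain \<delta> where \<delta>: "\<delta> > 0" and conv: "strongly_convex A g (rball A g (\<psi> q0) \<delta>)"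
    using prox unfolding prox_regular_at_def by blast
  let ?U = "rball A g (\<psi> q0) \<delta>"
  have int: "\<psi> q0 \<in> interior ?U"
  proof (rule \<psi>_interior_rball[of "min R (\<delta> / \<Lambda>)"])
    have "\<Lambda> * min R (\<delta> / \<Lambda>) \<le> \<Lambda> * (\<delta> / \<Lambda>)" using \<Lambda>_pos by (intro mult_left_mono) auto
    then show "\<Lambda> * min R (\<delta> / \<Lambda>) \<le> \<delta>" using \<Lambda>_pos by simp
  qed (use R_pos \<delta> \<Lambda>_pos in auto)
  then have x: "\<psi> q0 \<in> ?U" using interior_subset by blast
  \<comment> \<open>The 2 keeps even \<open>t 0\<close> strictly below \<epsilon>, since the
    parameter interval is half-open.\<close>
  define t where "t i = \<epsilon> / (real i + 2)" for i
  have t: "t i > 0" "t i \<in> {0..<\<epsilon>}" for i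
    using \<alpha>(1) by (auto simp: t_def field_simps intro!: add_pos_nonneg)
  have "(\<lambda>i. \<epsilon> * (1 / real (i + 2))) \<longlonglongrightarrow> \<epsilon> * 0"
    by (intro tendsto_mult tendsto_const LIMSEQ_ignore_initial_segment[OF lim_1_over_n])
  then have t0: "t \<longlonglongrightarrow> 0" by (simp add: t_def[abs_def] add.commute)
  have "decseq t" using \<alpha>(1) by (auto simp: t_def decseq_def intro!: divide_left_mono)
  have ft: "filterlim t (at 0 within {0..<\<epsilon>}) sequentially"
    unfolding filterlim_at using t0 t by (auto simp: less_imp_neq[symmetric])
  have \<alpha>t: "(\<lambda>i. \<alpha> (t i)) \<longlonglongrightarrow> \<psi> q0"
    using filterlim_compose[OF cont[unfolded continuous_within] ft] \<alpha>(3) by simp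
  have "\<forall>\<^sub>F i in sequentially. \<alpha> (t i) \<in> interior ?U"
    by (rule topological_tendstoD[OF \<alpha>t open_interior int])
  then obtain N where N: "\<And>i. i \<ge> N \<Longrightarrow> \<alpha> (t i) \<in> ?U"
    using interior_subset by (force simp: eventually_sequentially)
  define z \<tau> where "z i = \<alpha> (t (i + N))" and "\<tau> i = t (i + N)" for i
  have zU: "range z \<subseteq> ?U \<inter> S" using N t \<alpha>(2) by (auto simp: z_def)
  then have zU': "range z \<subseteq> ?U" by simp
  have z0: "z \<longlonglongrightarrow> \<psi> q0" unfolding z_def using \<alpha>t by (rule LIMSEQ_ignore_initial_segment)
  have \<tau>: "0 < \<tau> i" for i by (simp add: \<tau>_def t)
  have "((\<lambda>s. (1 / norm (s - 0)) *\<^sub>R (\<phi> (\<alpha> s) - (\<phi> (\<alpha> 0) + (s - 0) *\<^sub>R v c))) \<longlongrightarrow> 0) (at 0 within {0..<\<epsilon>})"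
    using der unfolding has_vector_derivative_def has_derivative_within by blast
  from filterlim_compose[OF this ft]
  have "(\<lambda>i. (1 / norm (t i)) *\<^sub>R (\<phi> (\<alpha> (t i)) - (q0 + t i *\<^sub>R v c))) \<longlonglongrightarrow> 0"
    using \<alpha>(3) q0 by simp
  moreover have "(1 / norm (t i)) *\<^sub>R (\<phi> (\<alpha> (t i)) - (q0 + t i *\<^sub>R v c)) = (\<phi> (\<alpha> (t i)) - q0) /\<^sub>R t i - v c" for i
    using t(1)[of i] by (simp add: algebra_simps divide_inverse)
  ultimately have "(\<lambda>i. (\<phi> (\<alpha> (t i)) - q0) /\<^sub>R t i) \<longlonglongrightarrow> v c"
    by (simp add: LIM_zero_iff)
  then have "(\<lambda>i. (\<phi> (z i) - q0) /\<^sub>R \<tau> i) \<longlonglongrightarrow> v c"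
    unfolding z_def \<tau>_def by (rule LIMSEQ_ignore_initial_segment)
  then have "(\<lambda>i. exp_inv A g (\<psi> q0) (z i) c /\<^sub>R \<tau> i) \<longlonglongrightarrow> v c"
    using exp_inv_quotient_iff[OF conv x zU' z0 \<tau>] by simp
  then have "\<forall>c'\<in>A. \<psi> q0 \<in> fst c' \<longrightarrow> (\<lambda>i. exp_inv A g (\<psi> q0) (z i) c' /\<^sub>R \<tau> i) \<longlonglongrightarrow> v c'"
    using vec_tendsto_all_charts[OF c \<psi>_in[OF q0] vT exp_inv_in[OF conv x]] zU' by (meson rangeI subsetD)
  moreover have "decseq \<tau>" using \<open>decseq t\<close> by (auto simp: \<tau>_def decseq_def)
  moreover have "\<tau> \<longlonglongrightarrow> 0" unfolding \<tau>_def using t0 by (rule LIMSEQ_ignore_initial_segment)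
  moreover have "convex_nbhd A g (\<psi> q0) ?U" using int conv by (simp add: convex_nbhd_def)
  ultimately show ?thesis
    unfolding bouligand_cone_def mem_Collect_eq
    by (intro conjI vT exI[of _ ?U] exI[of _ z] exI[of _ \<tau>] zU z0 allI \<tau>) simp_all
qed

end

theorem corollary4p3:
  fixes A :: "('m::{t2_space, second_countable_topology}, 'e::euclidean_space) chart set"
    and g :: "('m, 'e) metric"
    and S :: "'m set" and x :: 'm and v :: "('m, 'e) tvec"
  assumes "riemannian_manifold A g"
    and "closed S" and "prox_regular A g S"
    and "x \<in> S" and "v \<in> tangent_space A x"
  shows "v \<in> bouligand_cone A g S x \<longleftrightarrow>
    (\<exists>\<epsilon>>0. \<exists>\<alpha> :: real \<Rightarrow> 'm. continuous_on {0..<\<epsilon>} \<alpha> \<and> \<alpha> ` {0..<\<epsilon>} \<subseteq> S \<and> \<alpha> 0 = x \<and>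
       has_velocity A \<alpha> v 0 {0..<\<epsilon>})"
proof -
  interpret riemannian A g by unfold_locales (rule assms(1))
  obtain k where k: "k \<in> A" "x \<in> fst k" using ex_chart by blast
  obtain R \<Lambda> where "riemannian_chart A g k (snd k x) R \<Lambda>" using ex_riemannian_chart[OF k] by blast
  then interpret riemannian_chart A g k "snd k x" R \<Lambda> .
  have x: "chart_inv k (snd k x) = x" using k by simp
  have "prox_regular_at A g S x" using assms(3,4) by (simp add: prox_regular_def)
  then show ?thesis
    using bouligand_imp_curve[of S v] curve_imp_bouligand[of S _ _ v] assms(2,4)
    unfolding x by blast
qed

end
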